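(* Assume (A1). Then the set of Mather measures (for $P=0$) is not empty; that is, there exists a Radon probability measure $\mu$ on $\mathbb{T}^n\times\mathbb{R}^n$ such that (a) $\displaystyle\int_{\mathbb{T}^n\times\mathbb{R}^n}H(x,p)\,d\mu(x,p)=\overline H(0)=H(x,p)$ for $\mu$-a.e. $(x,p)$; (b) $\displaystyle\int_{\mathbb{T}^n\times\mathbb{R}^n}D_pH(x,p)\cdot p\,d\mu(x,p)=0$; (c) $\displaystyle\int_{\mathbb{T}^n\times\mathbb{R}^n}D_pH(x,p)\cdot D\phi(x)\,d\mu(x,p)=0$ for all $\phi\in C^2(\mathbb{T}^n)$.
   Context: $\mathbb{T}^n=\mathbb{R}^n/\mathbb{Z}^n$; $H\in C^2(\mathbb{T}^n\times\mathbb{R}^n)$ is given. (A1): $\displaystyle\lim_{|p|\to\infty}\min_{x\in\mathbb{T}^n}\Big(\tfrac12 H(x,p)^2+D_xH(x,p)\cdot p\Big)=+\infty.$ $\overline H(0)$ is the unique real constant for which the cell problem $H(x,Dv_0(x))=\overline H(0)$ in $\mathbb{T}^n$ has a viscosity solution $v_0\in C(\mathbb{T}^n)$. A Mather measure (for $P=0$) is a Radon probability measure on $\mathbb{T}^n\times\mathbb{R}^n$ satisfying (a), (b), (c). *)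

theory Defs
  imports "HOL-Analysis.Analysis" "HOL-Probability.Probability"
begin

section \<open>The torus \<open>\<real>\<^sup>n / \<int>\<^sup>n\<close>\<close>

definition lattice_eq :: "real ^ 'n \<Rightarrow> real ^ 'n \<Rightarrow> bool" where
  "lattice_eq x y \<longleftrightarrow> (\<forall>i. x $ i - y $ i \<in> \<int>)"

lemma equivp_lattice_eq: "equivp lattice_eq"
proof (rule equivpI)
  show "reflp lattice_eq" by (simp add: reflp_def lattice_eq_def)
  show "symp lattice_eq"
    by (auto simp: symp_def lattice_eq_def) (metis Ints_minus minus_diff_eq)
  show "transp lattice_eq"
    unfolding transp_def lattice_eq_def
    by (metis Ints_add diff_add_cancel add_diff_eq)
qed

quotient_type (overloaded) 'n torus = "real ^ ('n::finite)" / lattice_eq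
  by (rule equivp_lattice_eq)

abbreviation to_torus :: "real ^ 'n::finite \<Rightarrow> 'n torus" where
  "to_torus \<equiv> abs_torus"

lemma to_torus_eq_iff: "to_torus x = to_torus y \<longleftrightarrow> (\<forall>i. x $ i - y $ i \<in> \<int>)"
  by (simp add: torus.abs_eq_iff lattice_eq_def)

text \<open>Quotient topology.\<close>

instantiation torus :: (finite) topological_space
begin

definition open_torus :: "'a torus set \<Rightarrow> bool" where
  "open_torus U \<longleftrightarrow> open (to_torus -` U)"

instance
proof
  show "open (UNIV :: 'a torus set)" by (simp add: open_torus_def)
  show "open (S \<inter> T)" if "open S" "open T" for S T :: "'a torus set"
    using that by (simp add: open_torus_def vimage_Int open_Int)
  show "open (\<Union> K)" if "\<forall>S\<in>K. open S" for K :: "'a torus set set"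
    using that by (auto simp: open_torus_def vimage_Union)
qed

end

section \<open>Differentiability and gradients\<close>

definition C1 :: "('a::real_normed_vector \<Rightarrow> real) \<Rightarrow> bool" where
  "C1 f \<longleftrightarrow> (\<exists>f' :: 'a \<Rightarrow> 'a \<Rightarrow>\<^sub>L real.
     (\<forall>x. (f has_derivative blinfun_apply (f' x)) (at x)) \<and> continuous_on UNIV f')"

definition C2 :: "('a::real_normed_vector \<Rightarrow> real) \<Rightarrow> bool" where
  "C2 f \<longleftrightarrow> (\<exists>(f' :: 'a \<Rightarrow> 'a \<Rightarrow>\<^sub>L real) (f'' :: 'a \<Rightarrow> 'a \<Rightarrow>\<^sub>L 'a \<Rightarrow>\<^sub>L real).
     (\<forall>x. (f has_derivative blinfun_apply (f' x)) (at x)) \<and>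
     (\<forall>x. (f' has_derivative blinfun_apply (f'' x)) (at x)) \<and>
     continuous_on UNIV f'')"

definition grad :: "('a::real_inner \<Rightarrow> real) \<Rightarrow> 'a \<Rightarrow> 'a" where
  "grad f x = (THE D. GDERIV f x :> D)"

text \<open>Functions on the torus are differentiated through their periodic lifts to \<open>\<real>\<^sup>n\<close>;
  by periodicity the chosen representative of the base point is irrelevant
  (lemma \<open>torus_grad_to_torus\<close>).\<close>

definition torus_grad :: "('n::finite torus \<Rightarrow> real) \<Rightarrow> 'n torus \<Rightarrow> real ^ 'n" where
  "torus_grad \<phi> x = grad (\<phi> \<circ> to_torus) (rep_torus x)"

lemma torus_grad_to_torus: "torus_grad \<phi> (to_torus y) = grad (\<phi> \<circ> to_torus) y"
proof -
  define f where "f = \<phi> \<circ> to_torus"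
  define k where "k = rep_torus (to_torus y) - y"
  have "to_torus (rep_torus (to_torus y)) = to_torus y"
    by (rule Quotient_abs_rep[OF Quotient_torus])
  then have k: "k $ i \<in> \<int>" for i
    by (simp add: to_torus_eq_iff k_def)
  have per: "f (z + k) = f z" for z
  proof -
    have "to_torus (z + k) = to_torus z"
      using k by (simp add: to_torus_eq_iff)
    then show ?thesis by (simp add: f_def)
  qed
  have "GDERIV f (y + k) :> D \<longleftrightarrow> GDERIV f y :> D" for D
  proof -
    have "(f has_derivative g) (at (k + y)) \<longleftrightarrow> ((f \<circ> (+) k) has_derivative g) (at y)" for g
    proof
      assume a: "(f has_derivative g) (at (k + y))"
      have "((\<lambda>z. k + z) has_derivative (\<lambda>h. h)) (at y)"
        by (auto intro!: derivative_eq_intros)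
      from has_derivative_compose[OF this a] show "((f \<circ> (+) k) has_derivative g) (at y)"
        by (simp add: o_def)
    next
      assume a: "((f \<circ> (+) k) has_derivative g) (at y)"
      have b: "((\<lambda>z. z - k) has_derivative (\<lambda>h. h)) (at (k + y))"
        by (auto intro!: derivative_eq_intros)
      have "((f \<circ> (+) k) has_derivative g) (at (k + y - k))" using a by simp
      from has_derivative_compose[OF b this] show "(f has_derivative g) (at (k + y))"
        by (simp add: o_def)
    qed
    moreover have "f \<circ> (+) k = f" by (auto simp: fun_eq_iff per add.commute)
    ultimately show ?thesis by (simp add: gderiv_def add.commute)
  qed
  then have "grad f (y + k) = grad f y" by (simp add: grad_def)
  then show ?thesis by (simp add: torus_grad_def f_def k_def)
qed

definition C1_torus :: "('n::finite torus \<Rightarrow> real) \<Rightarrow> bool" where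
  "C1_torus \<phi> \<longleftrightarrow> C1 (\<phi> \<circ> to_torus)"

definition C2_torus :: "('n::finite torus \<Rightarrow> real) \<Rightarrow> bool" where
  "C2_torus \<phi> \<longleftrightarrow> C2 (\<phi> \<circ> to_torus)"

definition C2_phase :: "('n::finite torus \<times> (real ^ 'n) \<Rightarrow> real) \<Rightarrow> bool" where
  "C2_phase H \<longleftrightarrow> C2 (\<lambda>(x, p). H (to_torus x, p))"

definition Dx :: "('n::finite torus \<times> (real ^ 'n) \<Rightarrow> real) \<Rightarrow> 'n torus \<times> (real ^ 'n) \<Rightarrow> real ^ 'n" where
  "Dx H = (\<lambda>(x, p). torus_grad (\<lambda>y. H (y, p)) x)"

definition Dp :: "('n::finite torus \<times> (real ^ 'n) \<Rightarrow> real) \<Rightarrow> 'n torus \<times> (real ^ 'n) \<Rightarrow> real ^ 'n" where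
  "Dp H = (\<lambda>(x, p). grad (\<lambda>q. H (x, q)) p)"

section \<open>The growth condition and the cell problem\<close>

text \<open>The minimum over the torus is rendered by the infimum: for a Hamiltonian of class \<open>C\<^sup>2\<close>
  the function is continuous in \<open>x\<close> on a compact space, so the infimum is attained.\<close>

definition cond_A1 :: "('n::finite torus \<times> (real ^ 'n) \<Rightarrow> real) \<Rightarrow> bool" where
  "cond_A1 H \<longleftrightarrow>
     filterlim (\<lambda>p. INF x. (1/2) * (H (x, p))\<^sup>2 + Dx H (x, p) \<bullet> p) at_top at_infinity"

definition viscosity_subsolution ::
    "('n::finite torus \<times> (real ^ 'n) \<Rightarrow> real) \<Rightarrow> real \<Rightarrow> ('n torus \<Rightarrow> real) \<Rightarrow> bool" where
  "viscosity_subsolution H c v \<longleftrightarrow>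
     (\<forall>\<phi> x. C1_torus \<phi> \<longrightarrow> (\<forall>\<^sub>F y in nhds x. v y - \<phi> y \<le> v x - \<phi> x) \<longrightarrow>
        H (x, torus_grad \<phi> x) \<le> c)"

definition viscosity_supersolution ::
    "('n::finite torus \<times> (real ^ 'n) \<Rightarrow> real) \<Rightarrow> real \<Rightarrow> ('n torus \<Rightarrow> real) \<Rightarrow> bool" where
  "viscosity_supersolution H c v \<longleftrightarrow>
     (\<forall>\<phi> x. C1_torus \<phi> \<longrightarrow> (\<forall>\<^sub>F y in nhds x. v y - \<phi> y \<ge> v x - \<phi> x) \<longrightarrow>
        H (x, torus_grad \<phi> x) \<ge> c)"

definition viscosity_solution ::
    "('n::finite torus \<times> (real ^ 'n) \<Rightarrow> real) \<Rightarrow> real \<Rightarrow> ('n torus \<Rightarrow> real) \<Rightarrow> bool" where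
  "viscosity_solution H c v \<longleftrightarrow> continuous_on UNIV v \<and>
     viscosity_subsolution H c v \<and> viscosity_supersolution H c v"

text \<open>\<open>c\<close> is the effective Hamiltonian at \<open>P = 0\<close>: the unique constant for which the
  cell problem \<open>H (x, Dv) = c\<close> is solvable.\<close>

definition is_effective_H0 :: "('n::finite torus \<times> (real ^ 'n) \<Rightarrow> real) \<Rightarrow> real \<Rightarrow> bool" where
  "is_effective_H0 H c \<longleftrightarrow>
     (\<exists>v. viscosity_solution H c v) \<and> (\<forall>c'. (\<exists>v. viscosity_solution H c' v) \<longrightarrow> c' = c)"

section \<open>Mather measures\<close>

definition radon_prob :: "'a::topological_space measure \<Rightarrow> bool" where
  "radon_prob \<mu> \<longleftrightarrow> prob_space \<mu> \<and> sets \<mu> = sets borel \<and>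
     (\<forall>A \<in> sets \<mu>. emeasure \<mu> A = (SUP K \<in> {K. compact K \<and> K \<in> sets \<mu> \<and> K \<subseteq> A}. emeasure \<mu> K))"

text \<open>Integrability is stated explicitly because the Bochner integral of a non-integrable
  function is \<open>0\<close> by convention.\<close>

definition mather_measure ::
    "('n::finite torus \<times> (real ^ 'n) \<Rightarrow> real) \<Rightarrow> real \<Rightarrow> ('n torus \<times> (real ^ 'n)) measure \<Rightarrow> bool" where
  "mather_measure H c \<mu> \<longleftrightarrow>
     radon_prob \<mu> \<and>
     (integrable \<mu> H \<and> (\<integral>z. H z \<partial>\<mu>) = c \<and> (AE z in \<mu>. H z = c)) \<and>
     (integrable \<mu> (\<lambda>(x, p). Dp H (x, p) \<bullet> p) \<and>
        (\<integral>(x, p). Dp H (x, p) \<bullet> p \<partial>\<mu>) = 0) \<and>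
     (\<forall>\<phi>. C2_torus \<phi> \<longrightarrow>
        integrable \<mu> (\<lambda>(x, p). Dp H (x, p) \<bullet> torus_grad \<phi> x) \<and>
        (\<integral>(x, p). Dp H (x, p) \<bullet> torus_grad \<phi> x \<partial>\<mu>) = 0)"

end

theory Submission
  imports Defs
begin

text \<open>
  Mather measures are usually obtained by a limiting procedure (vanishing viscosity together with
  the adjoint linearised equation, or minimisation of an action when \<open>H\<close> is convex). The three
  requirements, however, are linear in the measure: once a measure is carried by the level set
  \<open>K = {H = c}\<close>, with \<open>c\<close> the effective Hamiltonian, it only has to annihilate the linear space \<open>V\<close>
  of the functions \<open>D\<^sub>pH \<bullet> (D\<phi> + a p)\<close>, with \<open>\<phi>\<close> of class \<open>C\<^sup>2\<close> and \<open>a\<close> real. The proof is by duality.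

  If \<open>K\<close> is compact, then a probability measure on \<open>K\<close> annihilating \<open>V\<close> exists unless some member
  of \<open>V\<close> is strictly positive on \<open>K\<close>. The cell problem excludes this: for \<open>a \<noteq> 0\<close> let
  \<open>\<psi> = - \<phi> / a\<close> and let \<open>v\<close> be a viscosity solution; at a maximum point of \<open>v - \<psi>\<close> one has
  \<open>H(x, D\<psi>) \<le> c\<close>, at a minimum point \<open>H(x, D\<psi>) \<ge> c\<close>, hence by connectedness \<open>H(x, D\<psi>(x)) = c\<close> at
  some \<open>x\<close>. The point \<open>(x, D\<psi>(x))\<close> lies in \<open>K\<close>, and the vector \<open>D\<phi> + a p\<close> vanishes there
  (\<open>ex_level_point_cancelling\<close>). The case \<open>a = 0\<close> follows by perturbing \<open>a\<close>.

  Condition (A1) enters through the compactness of \<open>K\<close> (\<open>level_set_bounded\<close>). For large \<open>p\<close>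
  it gives \<open>D\<^sub>xH(x, p) \<bullet> p > 0\<close> wherever \<open>H(x, p) = c\<close>, so that along the line
  \<open>t \<mapsto> x + t p\<close> the value \<open>c\<close> is crossed only upwards and at most once; this contradicts the
  recurrence of linear flows on the torus.

  The duality principle (\<open>ex_annihilating_measure\<close>) is proved without a separation theorem and
  without Riesz representation. A greedy choice of points, as in Blackwell's approachability theorem,
  makes the averages of finitely many members of \<open>V\<close> arbitrarily small. A space-filling curve turns
  the resulting empirical measures on \<open>K\<close> into measures on the unit interval, where Helly's theorem
  supplies a weak limit, which is then pushed forward along the curve.
\<close>

section \<open>A space-filling curve\<close>

text \<open>
  Schoenberg's curve. The plateau function is 2-periodic, vanishes on \<open>[0, 1/3]\<close> and equals 1 on
  \<open>[2/3, 1]\<close>, so that its value at \<open>3\<^sup>k t\<close> tells whether the \<open>k\<close>-th ternary digit of a point \<open>t\<close> of the Cantor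
  set is 0 or 2.
\<close>

definition plateau :: "real \<Rightarrow> real" where
  "plateau s = max 0 (min 1 (1 / 2 - cos (pi * s)))"

lemma plateau_bounds: "0 \<le> plateau s" "plateau s \<le> 1"
  by (auto simp: plateau_def)

lemma continuous_on_plateau: "continuous_on UNIV plateau"
  unfolding plateau_def by (intro continuous_intros)

lemma plateau_periodic: "plateau (s + 2 * of_nat n) = plateau s"
proof -
  have "cos (pi * (s + 2 * of_nat n)) = cos (pi * s + 2 * of_nat n * pi)"
    by (simp add: algebra_simps)
  also have "\<dots> = cos (pi * s)"
    by (simp only: cos_add cos_2npi sin_2npi)
  finally show ?thesis by (simp add: plateau_def)
qed

lemma plateau_digit:
  assumes "0 \<le> u" "u \<le> 1"
  shows "plateau ((2 * of_bool d + u) / 3) = of_bool d"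
proof (cases d)
  case False
  have "cos (pi / 3) \<le> cos (pi * (u / 3))"
    using assms by (intro cos_monotone_0_pi_le) (auto simp: field_simps)
  then show ?thesis using False by (simp add: plateau_def cos_60)
next
  case True
  have "cos (pi / 3) \<le> cos (pi * ((1 - u) / 3))"
    using assms by (intro cos_monotone_0_pi_le) (auto simp: field_simps)
  moreover have "pi * ((2 + u) / 3) = pi - pi * ((1 - u) / 3)" by (simp add: field_simps)
  then have "cos (pi * ((2 + u) / 3)) = - cos (pi * ((1 - u) / 3))"
    by (simp only: cos_pi_minus)
  ultimately show ?thesis using True by (simp add: plateau_def cos_60)
qed

definition cantor_point :: "(nat \<Rightarrow> bool) \<Rightarrow> real" where
  "cantor_point d = (\<Sum>k. 2 * of_bool (d k) / 3 ^ Suc k)"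

lemma summable_cantor_point: "summable (\<lambda>k. 2 * of_bool (d k) / 3 ^ Suc k :: real)"
  by (rule summable_comparison_test[OF _ summable_mult[OF summable_geometric[of "1/3::real"], of 2]])
     (auto simp: of_bool_def power_divide field_simps)

lemma cantor_point_bounds: "0 \<le> cantor_point d" "cantor_point d \<le> 1"
proof -
  show "0 \<le> cantor_point d"
    unfolding cantor_point_def by (intro suminf_nonneg summable_cantor_point) auto
  have s: "(\<lambda>k. 2 / 3 * (1 / 3) ^ k :: real) sums (2 / 3 * (1 / (1 - 1 / 3)))"
    by (intro sums_mult geometric_sums) auto
  have "cantor_point d \<le> (\<Sum>k. 2 / 3 * (1 / 3) ^ k)"
    unfolding cantor_point_def
    by (intro suminf_le summable_cantor_point sums_summable[OF s]) (auto simp: power_divide)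
  then show "cantor_point d \<le> 1" using sums_unique[OF s] by simp
qed

lemma cantor_point_shift:
  "cantor_point d = (2 * of_bool (d 0) + cantor_point (\<lambda>k. d (Suc k))) / 3"
proof -
  have "cantor_point d = 2 * of_bool (d 0) / 3 + (\<Sum>k. 2 * of_bool (d (Suc k)) / 3 ^ Suc (Suc k))"
    using suminf_split_initial_segment[OF summable_cantor_point, of d 1]
    by (simp add: cantor_point_def)
  also have "(\<Sum>k. 2 * of_bool (d (Suc k)) / 3 ^ Suc (Suc k) :: real)
      = (\<Sum>k. (2 * of_bool (d (Suc k)) / 3 ^ Suc k) / 3)"
    by (simp add: field_simps)
  also have "\<dots> = cantor_point (\<lambda>k. d (Suc k)) / 3"
    unfolding cantor_point_def by (rule suminf_divide[OF summable_cantor_point])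
  finally show ?thesis by (simp add: field_simps)
qed

text \<open>
  Multiplication by 3 shifts the digits and adds an even integer, which is invisible to a
  2-periodic function.
\<close>

lemma plateau_cantor_point: "plateau (3 ^ k * cantor_point d) = of_bool (d k)"
proof (induction k arbitrary: d)
  case 0
  show ?case using plateau_digit[of "cantor_point (\<lambda>k. d (Suc k))" "d 0"]
      cantor_point_bounds[of "\<lambda>k. d (Suc k)"]
    unfolding cantor_point_shift[of d, symmetric] by simp
next
  case (Suc k)
  have "3 ^ Suc k * cantor_point d
      = 3 ^ k * cantor_point (\<lambda>k. d (Suc k)) + 2 * of_nat (3 ^ k * of_bool (d 0))"
    by (subst cantor_point_shift) (simp add: field_simps)
  then have "plateau (3 ^ Suc k * cantor_point d) = plateau (3 ^ k * cantor_point (\<lambda>k. d (Suc k)))"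
    by (metis plateau_periodic)
  then show ?case using Suc[of "\<lambda>k. d (Suc k)"] by (rule trans)
qed

text \<open>
  The digits are \<open>\<lfloor>2\<^sup>k\<^sup>+\<^sup>1 y\<rfloor> mod 2\<close>: the corresponding terms telescope along the dyadic approximations
  \<open>\<lfloor>2\<^sup>k y\<rfloor> / 2\<^sup>k\<close> of \<open>y\<close>. The point \<open>y = 1\<close> is left out because its digits computed in this
  way are all 0.
\<close>

lemma ex_binary_digits:
  fixes y :: real
  assumes "0 \<le> y" "y < 1"
  shows "\<exists>d. (\<lambda>k. of_bool (d k) / 2 ^ Suc k) sums y"
proof -
  define t where "t k = real_of_int \<lfloor>2 ^ k * y\<rfloor> / 2 ^ k" for k
  have "of_bool (odd \<lfloor>2 ^ Suc k * y\<rfloor>) / 2 ^ Suc k = t (Suc k) - t k" for k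
  proof -
    have "\<lfloor>2 ^ k * y\<rfloor> = \<lfloor>2 ^ Suc k * y / 2\<rfloor>" by simp
    also have "\<dots> = \<lfloor>2 ^ Suc k * y\<rfloor> div 2"
      using floor_divide_real_eq_div[of 2 "2 ^ Suc k * y"] by simp
    finally have e: "\<lfloor>2 ^ k * y\<rfloor> = \<lfloor>2 ^ Suc k * y\<rfloor> div 2" .
    define n where "n = \<lfloor>2 ^ Suc k * y\<rfloor>"
    have "n = 2 * (n div 2) + of_bool (odd n)" by (auto elim!: evenE oddE)
    then have "real_of_int n = 2 * real_of_int (n div 2) + of_bool (odd n)"
      by (metis of_int_add of_int_mult of_int_numeral of_int_of_bool)
    then show ?thesis unfolding t_def e by (fold n_def) (simp add: field_simps)
  qed
  moreover have "t \<longlonglongrightarrow> y"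
  proof (rule real_tendsto_sandwich)
    show "(\<lambda>k. y - (1 / 2) ^ k) \<longlonglongrightarrow> y"
      using tendsto_diff[OF tendsto_const[of y] LIMSEQ_power_zero[of "1 / 2 :: real"]] by simp
    have "y - (1 / 2) ^ k \<le> t k" for k
    proof -
      have "2 ^ k * y - 1 \<le> \<lfloor>2 ^ k * y\<rfloor>" by linarith
      then have "(2 ^ k * y - 1) / 2 ^ k \<le> t k" unfolding t_def by (intro divide_right_mono) auto
      then show ?thesis by (simp add: diff_divide_distrib power_divide)
    qed
    then show "\<forall>\<^sub>F k in sequentially. y - (1 / 2) ^ k \<le> t k" by simp
    show "\<forall>\<^sub>F k in sequentially. t k \<le> y"
      by (auto simp: t_def field_simps)
  qed auto
  then have "(\<lambda>k. t (Suc k) - t k) sums (y - t 0)" by (rule telescope_sums)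
  moreover have "t 0 = 0" using assms by (simp add: t_def floor_eq_iff)
  ultimately show ?thesis by (intro exI[of _ "\<lambda>k. odd \<lfloor>2 ^ Suc k * y\<rfloor>"]) simp
qed

text \<open>
  The pairing function distributes the digits of one point of the Cantor set over infinitely
  many coordinates, so that a single sequence of curves serves every dimension.
\<close>

definition schoenberg :: "nat \<Rightarrow> real \<Rightarrow> real" where
  "schoenberg i t = (\<Sum>k. plateau (3 ^ prod_encode (i, k) * t) / 2 ^ Suc k)"

lemma schoenberg_term_le: "norm (plateau s / 2 ^ Suc k) \<le> 1 / 2 * (1 / 2) ^ k"
  using plateau_bounds[of s] by (auto simp: power_divide field_simps)

lemma continuous_on_schoenberg: "continuous_on UNIV (schoenberg i)"
proof -
  have "uniform_limit UNIV (\<lambda>n t. \<Sum>k<n. plateau (3 ^ prod_encode (i, k) * t) / 2 ^ Suc k)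
      (schoenberg i) sequentially"
    unfolding schoenberg_def
    by (rule Weierstrass_m_test[where M = "\<lambda>k. 1 / 2 * (1 / 2) ^ k"])
       (rule schoenberg_term_le, intro summable_mult summable_geometric, simp)
  moreover have "continuous_on UNIV (\<lambda>t. \<Sum>k<n. plateau (3 ^ prod_encode (i, k) * t) / 2 ^ Suc k)" for n
    by (intro continuous_intros continuous_on_compose2[OF continuous_on_plateau]) auto
  ultimately show ?thesis
    using uniform_limit_theorem[OF always_eventually, where f = "\<lambda>n t. \<Sum>k<n. plateau (3 ^ prod_encode (i, k) * t) / 2 ^ Suc k"]
    by simp
qed

lemma schoenberg_bounds: "\<bar>schoenberg i t\<bar> \<le> 1"
proof -
  have s: "(\<lambda>k. 1 / 2 * (1 / 2) ^ k :: real) sums (1 / 2 * (1 / (1 - 1 / 2)))"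
    by (intro sums_mult geometric_sums) auto
  have "norm (schoenberg i t) \<le> (\<Sum>k. 1 / 2 * (1 / 2) ^ k)"
    unfolding schoenberg_def
    by (rule norm_suminf_le[OF schoenberg_term_le sums_summable[OF s]])
  then show ?thesis using sums_unique[OF s] by simp
qed

text \<open>
  All coordinates are prescribed at once by interleaving their binary digits into one Cantor point.
\<close>

lemma schoenberg_onto:
  assumes "\<And>i. 0 \<le> y i" "\<And>i. y i < 1"
  shows "\<exists>t\<in>{0..1}. \<forall>i. schoenberg i t = y i"
proof -
  obtain d where d: "\<And>i. (\<lambda>k. of_bool (d i k) / 2 ^ Suc k) sums y i"
    using ex_binary_digits[OF assms] by metis
  define e where "e n = (case prod_decode n of (i, k) \<Rightarrow> d i k)" for n
  have "schoenberg i (cantor_point e) = y i" for i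
    using sums_unique[OF d[of i]]
    by (simp add: schoenberg_def plateau_cantor_point e_def)
  then show ?thesis using cantor_point_bounds[of e] by (intro bexI[of _ "cantor_point e"]) auto
qed

lemma ex_space_filling_curve:
  fixes K :: "'a::euclidean_space set"
  assumes "bounded K"
  obtains g :: "real \<Rightarrow> 'a" where "continuous_on UNIV g" "bounded (range g)" "K \<subseteq> g ` {0..1}"
proof -
  obtain R where R: "R > 0" "\<And>z. z \<in> K \<Longrightarrow> norm z < R"
    using assms bounded_pos_less by metis
  obtain h :: "'a \<Rightarrow> nat" where h: "inj_on h Basis"
    using finite_imp_inj_to_nat_seg[OF finite_Basis] by metis
  define g where "g t = (\<Sum>b\<in>Basis. (2 * R * schoenberg (h b) t - R) *\<^sub>R b)" for t :: real
  show ?thesis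
  proof
    show "continuous_on UNIV g"
      unfolding g_def using continuous_on_schoenberg by (intro continuous_intros)
    have "\<bar>g t \<bullet> b\<bar> \<le> 3 * R" if "b \<in> Basis" for t b
    proof -
      have "\<bar>2 * R * schoenberg (h b) t - R\<bar> \<le> 2 * R * \<bar>schoenberg (h b) t\<bar> + R"
        using R(1) abs_triangle_ineq4[of "2 * R * schoenberg (h b) t" R] by (simp add: abs_mult)
      also have "\<dots> \<le> 2 * R * 1 + R"
        using schoenberg_bounds R(1) by (intro add_mono mult_left_mono) auto
      finally show ?thesis using that by (simp add: g_def inner_sum_left_Basis)
    qed
    then have "norm (g t) \<le> (\<Sum>b\<in>(Basis::'a set). 3 * R)" for t
      by (intro order_trans[OF norm_le_l1] sum_mono)
    then show "bounded (range g)" unfolding bounded_iff by blast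
    show "K \<subseteq> g ` {0..1}"
    proof
      fix z assume "z \<in> K"
      define y where "y i = (if i \<in> h ` Basis then (z \<bullet> inv_into Basis h i + R) / (2 * R) else 0)" for i
      have "\<bar>z \<bullet> b\<bar> < R" if "b \<in> Basis" for b
        using Basis_le_norm[OF that, of z] R(2)[OF \<open>z \<in> K\<close>] by linarith
      then have "0 \<le> y i" "y i < 1" for i
        using R(1) by (auto simp: y_def h inv_into_f_f field_simps abs_less_iff) force+
      then obtain t where t: "t \<in> {0..1}" "\<And>i. schoenberg i t = y i"
        using schoenberg_onto by metis
      have "g t = (\<Sum>b\<in>Basis. (z \<bullet> b) *\<^sub>R b)"
        unfolding g_def using R(1) by (intro sum.cong) (auto simp: t y_def h inv_into_f_f)
      then show "z \<in> g ` {0..1}" using t by (auto simp: euclidean_representation)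
    qed
  qed
qed

section \<open>Measures annihilating a space of continuous functions\<close>

text \<open>
  Separability of \<open>C(K)\<close>, inherited by every subset \<open>V\<close>. A function with a given modulus of continuity
  is determined up to a small uniform error by its values, rounded to a grid, on a finite net of
  \<open>K\<close>. There are countably many such codes, and one member of \<open>V\<close> is selected for each code that occurs.
\<close>

lemma ex_countable_uniformly_dense:
  fixes V :: "('a::metric_space \<Rightarrow> real) set"
  assumes K: "compact K" and cont: "\<And>f. f \<in> V \<Longrightarrow> continuous_on K f"
  obtains G where "countable G" "G \<subseteq> V"
    "\<And>f e. f \<in> V \<Longrightarrow> e > 0 \<Longrightarrow> \<exists>g\<in>G. \<forall>z\<in>K. \<bar>f z - g z\<bar> < e"
proof -
  have "\<exists>N. finite N \<and> N \<subseteq> K \<and> K \<subseteq> (\<Union>y\<in>N. ball y (1 / real (Suc k)))" for k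
    using compact_imp_seq_compact[OF K] seq_compact_imp_totally_bounded by fastforce
  then obtain N where N: "\<And>k. finite (N k)" "\<And>k. N k \<subseteq> K"
    "\<And>k. K \<subseteq> (\<Union>y\<in>N k. ball y (1 / real (Suc k)))" by metis
  define modulus where "modulus f k j \<longleftrightarrow>
    (\<forall>y\<in>K. \<forall>z\<in>K. dist y z < 1 / real (Suc k) \<longrightarrow> \<bar>f y - f z\<bar> < 1 / real (Suc j))"
    for f :: "'a \<Rightarrow> real" and k j
  define code where "code f k j = (\<lambda>y\<in>N k. \<lfloor>f y * real (Suc j)\<rfloor>)" for f :: "'a \<Rightarrow> real" and k j
  define I where "I = (SIGMA k:UNIV. SIGMA j:(UNIV :: nat set). PiE (N k) (\<lambda>_. UNIV :: int set))"
  define J where "J = {(k, j, c) \<in> I. \<exists>f\<in>V. modulus f k j \<and> code f k j = c}"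
  define pick where "pick = (\<lambda>(k, j, c). SOME f. f \<in> V \<and> modulus f k j \<and> code f k j = c)"
  have pick: "pick (k, j, c) \<in> V \<and> modulus (pick (k, j, c)) k j \<and> code (pick (k, j, c)) k j = c"
    if "(k, j, c) \<in> J" for k j c
  proof -
    have "\<exists>f. f \<in> V \<and> modulus f k j \<and> code f k j = c" using that by (auto simp: J_def)
    then show ?thesis unfolding pick_def split by (rule someI_ex)
  qed
  show ?thesis
  proof
    have "countable I" unfolding I_def
      using N(1) by (intro countable_SIGMA countable_PiE) auto
    then show "countable (pick ` J)"
      by (intro countable_image) (auto simp: J_def intro: countable_subset)
    show "pick ` J \<subseteq> V" using pick by auto
    fix f and e :: real assume f: "f \<in> V" and "e > 0"
    then obtain j where j: "1 / real (Suc j) < e / 3" using nat_approx_posE[of "e / 3"] by auto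
    have "uniformly_continuous_on K f"
      using compact_uniformly_continuous[OF cont[OF f] K] .
    moreover have "1 / real (Suc j) > 0" by simp
    ultimately obtain d where d: "d > 0"
      "\<And>y z. y \<in> K \<Longrightarrow> z \<in> K \<Longrightarrow> dist y z < d \<Longrightarrow> \<bar>f z - f y\<bar> < 1 / real (Suc j)"
      unfolding uniformly_continuous_on_def dist_real_def by (metis dist_commute)
    obtain k where "1 / real (Suc k) < d" using nat_approx_posE[OF \<open>d > 0\<close>] by auto
    then have mf: "modulus f k j" unfolding modulus_def
      using d(2) by (auto simp: abs_minus_commute)
    have inJ: "(k, j, code f k j) \<in> J"
      using f mf by (auto simp: J_def I_def code_def)
    define g where "g = pick (k, j, code f k j)"
    have g: "modulus g k j" "code g k j = code f k j" using pick[OF inJ] by (auto simp: g_def)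
    have "\<bar>f z - g z\<bar> < e" if "z \<in> K" for z
    proof -
      obtain y where y: "y \<in> N k" "dist y z < 1 / real (Suc k)" using N(3) \<open>z \<in> K\<close> by fastforce
      have "y \<in> K" using y N(2) by auto
      then have 1: "\<bar>f y - f z\<bar> < 1 / real (Suc j)" "\<bar>g y - g z\<bar> < 1 / real (Suc j)"
        using y \<open>z \<in> K\<close> mf g(1) unfolding modulus_def by auto
      have "\<lfloor>g y * real (Suc j)\<rfloor> = \<lfloor>f y * real (Suc j)\<rfloor>"
        using fun_cong[OF g(2), of y] y(1) by (simp add: code_def)
      then have "\<bar>f y * real (Suc j) - g y * real (Suc j)\<bar> < 1" by linarith
      then have "\<bar>f y - g y\<bar> * real (Suc j) < 1" by (simp add: abs_mult flip: left_diff_distrib)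
      then have "\<bar>f y - g y\<bar> < 1 / real (Suc j)" by (simp add: pos_less_divide_eq)
      then show ?thesis using 1 j by linarith
    qed
    then show "\<exists>g\<in>pick ` J. \<forall>z\<in>K. \<bar>f z - g z\<bar> < e" using inJ by (auto simp: g_def)
  qed
qed

text \<open>
  The greedy argument behind Blackwell's approachability theorem. Let \<open>s\<close> be the vector of the running
  sums of \<open>f 0, \<dots>, f (m - 1)\<close>. The next point is chosen such that its vector of values has a nonpositive inner
  product with \<open>s\<close>. Then \<open>\<bar>s\<bar>\<^sup>2\<close> grows by at most a constant \<open>C\<close> in each step, so that after \<open>T\<close> steps
  \<open>\<bar>s\<bar> \<le> sqrt (C T)\<close>, and the averages are \<open>O(1 / sqrt T)\<close>.
\<close>

lemma ex_small_averages:
  fixes f :: "nat \<Rightarrow> 'a \<Rightarrow> real"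
  assumes bd: "\<And>i z. z \<in> K \<Longrightarrow> \<bar>f i z\<bar> \<le> B i"
    and nonpos: "\<And>c. \<exists>z\<in>K. (\<Sum>i<m. c i * f i z) \<le> 0" and e: "e > 0"
  shows "\<exists>T z. T > 0 \<and> (\<forall>t::nat. z t \<in> K) \<and> (\<forall>i<m. \<bar>\<Sum>t<T. f i (z t)\<bar> \<le> e * real T)"
proof -
  define pick where "pick c = (SOME z. z \<in> K \<and> (\<Sum>i<m. c i * f i z) \<le> 0)" for c
  have pick: "pick c \<in> K" "(\<Sum>i<m. c i * f i (pick c)) \<le> 0" for c
    using someI_ex[OF nonpos[of c, unfolded Bex_def]] by (auto simp: pick_def)
  \<comment> \<open>The running sums determine the next point, hence also their own recursion.\<close>
  define s where "s = rec_nat (\<lambda>_. 0) (\<lambda>_ c i. c i + f i (pick c))"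
  define z where "z t = pick (s t)" for t
  have s_Suc: "s (Suc t) i = s t i + f i (z t)" for t i by (simp add: s_def z_def)
  have s_eq: "s t i = (\<Sum>u<t. f i (z u))" for t i
    by (induction t) (simp_all add: s_Suc, simp add: s_def)
  define C where "C = (\<Sum>i<m. (B i)\<^sup>2)"
  have bound: "(\<Sum>i<m. (s t i)\<^sup>2) \<le> C * real t" for t
  proof (induction t)
    case 0
    show ?case by (simp add: s_def)
  next
    case (Suc t)
    have "(\<Sum>i<m. (s (Suc t) i)\<^sup>2)
        = (\<Sum>i<m. (s t i)\<^sup>2) + 2 * (\<Sum>i<m. s t i * f i (z t)) + (\<Sum>i<m. (f i (z t))\<^sup>2)"
      by (simp add: s_Suc power2_sum sum.distrib sum_distrib_left algebra_simps)
    also have "\<dots> \<le> C * real t + 0 + C"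
    proof (intro add_mono Suc)
      show "2 * (\<Sum>i<m. s t i * f i (z t)) \<le> 0" using pick(2)[of "s t"] by (simp add: z_def)
      show "(\<Sum>i<m. (f i (z t))\<^sup>2) \<le> C" unfolding C_def
        using bd pick(1) by (intro sum_mono) (metis abs_le_square_iff abs_ge_zero abs_of_nonneg order_trans z_def)
    qed
    finally show ?case by (simp add: algebra_simps)
  qed
  define T where "T = Suc (nat \<lceil>C / e\<^sup>2\<rceil>)"
  have "C / e\<^sup>2 \<le> real T" unfolding T_def by linarith
  then have T: "C \<le> e\<^sup>2 * real T" using e by (simp add: field_simps)
  have "\<bar>s T i\<bar> \<le> e * real T" if "i < m" for i
  proof -
    have "(s T i)\<^sup>2 \<le> (\<Sum>i<m. (s T i)\<^sup>2)" using that by (intro member_le_sum) auto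
    also have "\<dots> \<le> e\<^sup>2 * real T * real T"
      using bound[of T] mult_right_mono[OF T, of "real T"] by linarith
    finally have "(s T i)\<^sup>2 \<le> (e * real T)\<^sup>2" by (simp add: power2_eq_square algebra_simps)
    then show ?thesis using e by (simp add: abs_le_square_iff[symmetric] abs_mult)
  qed
  then show ?thesis
    using pick(1) by (intro exI[of _ T] exI[of _ z]) (auto simp: s_eq z_def T_def)
qed

text \<open>
  The easy implication of this duality, that an annihilated function cannot be positive on \<open>K\<close>,
  shows that the last hypothesis is the right one. For the existence, empirical measures of the points found by the greedy choice almost
  annihilate more and more members of a countable dense subset of \<open>V\<close>. They are lifted along a
  space-filling curve \<open>g\<close> to probability measures on \<open>{0..1}\<close>, a tight sequence with a weak limit,
  and the image of this limit under \<open>g\<close> is the required measure. It is carried by \<open>K\<close> because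
  the distance from \<open>K\<close> is a continuous function whose empirical averages all vanish.
\<close>

theorem ex_annihilating_measure:
  fixes K :: "'a::euclidean_space set" and V :: "('a \<Rightarrow> real) set"
  assumes K: "compact K"
    and cont: "\<And>f. f \<in> V \<Longrightarrow> continuous_on UNIV f"
    and zero: "(\<lambda>_. 0) \<in> V"
    and lin: "\<And>f g a. f \<in> V \<Longrightarrow> g \<in> V \<Longrightarrow> (\<lambda>z. f z + a * g z) \<in> V"
    and nonpos: "\<And>f. f \<in> V \<Longrightarrow> \<exists>z\<in>K. f z \<le> 0"
  shows "\<exists>\<mu>. prob_space \<mu> \<and> sets \<mu> = sets borel \<and> (AE z in \<mu>. z \<in> K) \<and> (\<forall>f\<in>V. integral\<^sup>L \<mu> f = 0)"
proof -
  have contK: "continuous_on K f" if "f \<in> V" for f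
    using cont[OF that] continuous_on_subset by blast
  obtain G where G: "countable G" "G \<subseteq> V"
    "\<And>f e. f \<in> V \<Longrightarrow> e > 0 \<Longrightarrow> \<exists>g\<in>G. \<forall>z\<in>K. \<bar>f z - g z\<bar> < e"
    using ex_countable_uniformly_dense[OF K contK] by metis
  have "G \<noteq> {}" using G(3)[OF zero, of 1] by auto
  define F where "F = from_nat_into G"
  have rF: "range F = G" unfolding F_def using range_from_nat_into[OF \<open>G \<noteq> {}\<close> G(1)] .
  then have FV: "F i \<in> V" for i using G(2) by auto
  have "\<exists>B. \<forall>z\<in>K. \<bar>F i z\<bar> \<le> B" for i
    using compact_imp_bounded[OF compact_continuous_image[OF contK[OF FV] K], of i]
    by (auto simp: bounded_iff)
  then obtain B where B: "\<And>i z. z \<in> K \<Longrightarrow> \<bar>F i z\<bar> \<le> B i" by metis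
  \<comment> \<open>Linearity of \<open>V\<close> turns the sign condition into the hypothesis of the greedy argument.\<close>
  have comb: "(\<lambda>z. \<Sum>i<m. c i * F i z) \<in> V" for c and m :: nat
    by (induction m) (auto intro: zero lin FV)
  have "\<exists>T z. T > 0 \<and> (\<forall>t::nat. z t \<in> K) \<and> (\<forall>i<k. \<bar>\<Sum>t<T. F i (z t)\<bar> \<le> 1 / real (Suc k) * real T)" for k
    using B nonpos[OF comb] by (intro ex_small_averages) auto
  then obtain T z where T: "\<And>k. T k > 0" and z: "\<And>k t. z k t \<in> K"
    and avg: "\<And>k i. i < k \<Longrightarrow> \<bar>\<Sum>t<T k. F i (z k t)\<bar> \<le> 1 / real (Suc k) * real (T k)"
    by metis
  define A where "A k f = (\<Sum>t<T k. f (z k t)) / real (T k)" for k and f :: "'a \<Rightarrow> real"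
  have A_F: "\<bar>A k (F i)\<bar> \<le> 1 / real (Suc k)" if "i < k" for k i
    using avg[OF that] T[of k] by (simp add: A_def pos_divide_le_eq)
  have A_lim: "(\<lambda>k. A k f) \<longlonglongrightarrow> 0" if f: "f \<in> V" for f
  proof (rule LIMSEQ_I)
    fix e :: real assume "e > 0"
    then obtain i where i: "\<And>z. z \<in> K \<Longrightarrow> \<bar>f z - F i z\<bar> < e / 2"
      using G(3)[OF f half_gt_zero[OF \<open>e > 0\<close>]] rF by (metis imageE)
    obtain j where j: "1 / real (Suc j) < e / 2" using nat_approx_posE[of "e / 2"] \<open>e > 0\<close> by auto
    have "norm (A k f - 0) < e" if k: "k \<ge> Suc (max i j)" for k
    proof -
      have "\<bar>\<Sum>t<T k. f (z k t) - F i (z k t)\<bar> \<le> (\<Sum>t<T k. e / 2)"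
        using i[OF z] by (intro order_trans[OF sum_abs] sum_mono) (simp add: less_imp_le)
      then have "\<bar>A k f - A k (F i)\<bar> \<le> e / 2"
        using T[of k] by (simp add: A_def sum_subtractf pos_divide_le_eq mult.commute flip: diff_divide_distrib)
      moreover have "1 / real (Suc k) \<le> 1 / real (Suc j)" using k by (intro divide_left_mono) auto
      moreover have "\<bar>A k (F i)\<bar> \<le> 1 / real (Suc k)" using k by (intro A_F) auto
      ultimately show ?thesis using j unfolding diff_0_right real_norm_def by linarith
    qed
    then show "\<exists>no. \<forall>k\<ge>no. norm (A k f - 0) < e" by blast
  qed
  obtain g :: "real \<Rightarrow> 'a" where g: "continuous_on UNIV g" "bounded (range g)" "K \<subseteq> g ` {0..1}"
    using ex_space_filling_curve[OF compact_imp_bounded[OF K]] by metis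
  have "\<exists>u\<in>{0..1}. g u = z k t" for k t using g(3) z[of k t] by (metis imageE subsetD)
  then obtain \<tau> where \<tau>: "\<And>k t. \<tau> k t \<in> {0..1}" "\<And>k t. g (\<tau> k t) = z k t" by metis
  define M where "M k = distr (measure_pmf (pmf_of_set {..<T k})) borel (\<tau> k)" for k
  have Mint: "integral\<^sup>L (M k) (\<lambda>u. f (g u)) = A k f" if "continuous_on UNIV f" for k f
  proof -
    have "continuous_on UNIV (\<lambda>u. f (g u))"
      using continuous_on_compose2[OF that g(1)] by simp
    then have "integral\<^sup>L (M k) (\<lambda>u. f (g u)) = (\<integral>t. f (g (\<tau> k t)) \<partial>measure_pmf (pmf_of_set {..<T k}))"
      unfolding M_def by (intro integral_distr borel_measurable_continuous_onI) auto
    also have "\<dots> = A k f"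
      using T[of k] by (subst integral_pmf_of_set) (auto simp: \<tau>(2) A_def lessThan_empty_iff)
    finally show ?thesis .
  qed
  have M: "real_distribution (M k)" for k
    unfolding M_def by (intro prob_space.real_distribution_distr prob_space_measure_pmf) auto
  have "measure (M k) {-1<..1} = 1" for k
  proof -
    have "\<tau> k -` {-1<..1} = UNIV" using \<tau>(1)[of k] by (auto simp: set_eq_iff intro: less_le_trans[of "-1" 0])
    then show ?thesis unfolding M_def by (subst measure_distr) auto
  qed
  then have "\<forall>\<epsilon>>0. (-1::real) < 1 \<and> (\<forall>k. measure (M k) {-1<..1} > 1 - \<epsilon>)" by simp
  then have "tight M" unfolding tight_def using M by blast
  then obtain r M' where r: "strict_mono (r :: nat \<Rightarrow> nat)" "real_distribution M'" "weak_conv_m (M \<circ> id \<circ> r) M'"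
    using tight_imp_convergent_subsubsequence[OF _ strict_mono_id] by metis
  have pM': "prob_space M'" and sM': "sets M' = sets borel"
    using r(2) real_distribution.events_eq_borel by (auto simp: real_distribution_def)
  have lim: "(\<lambda>k. A (r k) f) \<longlonglongrightarrow> (\<integral>u. f (g u) \<partial>M')" and intg: "integrable M' (\<lambda>u. f (g u))"
    if f: "continuous_on UNIV f" for f
  proof -
    have c: "continuous_on UNIV (\<lambda>u. f (g u))"
      using continuous_on_compose2[OF f g(1)] by simp
    have "compact (closure (range g))" using g(2) by simp
    then have "bounded (f ` closure (range g))"
      by (intro compact_imp_bounded compact_continuous_image continuous_on_subset[OF f]) auto
    then obtain b where b: "\<And>u. norm (f (g u)) \<le> b"
      unfolding bounded_iff using closure_subset by (metis imageI rangeI subsetD)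
    have "(\<lambda>k. integral\<^sup>L ((M \<circ> id \<circ> r) k) (\<lambda>u. f (g u))) \<longlonglongrightarrow> (\<integral>u. f (g u) \<partial>M')"
      by (rule weak_conv_imp_integral_bdd_continuous_conv[OF _ r(2,3) _ b])
         (use M c in \<open>auto simp: continuous_on_eq_continuous_at\<close>)
    then show "(\<lambda>k. A (r k) f) \<longlonglongrightarrow> (\<integral>u. f (g u) \<partial>M')" by (simp add: Mint[OF f])
    show "integrable M' (\<lambda>u. f (g u))"
      using b borel_measurable_continuous_onI[OF c] measurable_cong_sets[OF sM' refl]
      by (intro finite_measure.integrable_const_bound[OF prob_space.axioms(1)[OF pM'], where B = b]) auto
  qed
  have gm: "g \<in> borel_measurable M'" 
    using borel_measurable_continuous_onI[OF g(1)] measurable_cong_sets[OF sM' refl] by blast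
  define \<mu> where "\<mu> = distr M' borel g"
  have int_\<mu>: "integral\<^sup>L \<mu> f = (\<integral>u. f (g u) \<partial>M')" if "continuous_on UNIV f" for f :: "'a \<Rightarrow> real"
    unfolding \<mu>_def using gm borel_measurable_continuous_onI[OF that] by (rule integral_distr)
  have "integral\<^sup>L \<mu> f = 0" if "f \<in> V" for f
    using LIMSEQ_unique[OF lim[OF cont[OF that]] LIMSEQ_subseq_LIMSEQ[OF A_lim[OF that] r(1), unfolded o_def]]
      int_\<mu>[OF cont[OF that]] by simp
  moreover have "AE u in M'. g u \<in> K"
  proof -
    have c: "continuous_on UNIV (\<lambda>y. infdist y K)" by (intro continuous_intros)
    have "A k (\<lambda>y. infdist y K) = 0" for k using z by (simp add: A_def)
    then have "(\<integral>u. infdist (g u) K \<partial>M') = 0" using LIMSEQ_unique[OF lim[OF c]] by simp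
    then have "AE u in M'. infdist (g u) K = 0"
      using integral_nonneg_eq_0_iff_AE[OF intg[OF c] AE_I2] infdist_nonneg by blast
    moreover have "K \<noteq> {}" using z by auto
    ultimately show ?thesis using in_closed_iff_infdist_zero[OF compact_imp_closed[OF K]] by simp
  qed
  then have "AE z in \<mu>. z \<in> K"
    unfolding \<mu>_def using gm compact_imp_closed[OF K] by (subst AE_distr_iff) auto
  moreover have "prob_space \<mu>" unfolding \<mu>_def by (rule prob_space.prob_space_distr[OF pM' gm])
  ultimately show ?thesis by (intro exI[of _ \<mu>]) (simp add: \<mu>_def)
qed

section \<open>Gradients of functions on Euclidean space\<close>

lemma grad_eqI:
  assumes "(f has_derivative (\<lambda>h. h \<bullet> D)) (at x)"
  shows "grad f x = D"
  unfolding grad_def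
proof (rule the_equality)
  show "GDERIV f x :> D" using assms by (simp add: gderiv_def)
  fix D' assume "GDERIV f x :> D'"
  then have "(\<lambda>h. h \<bullet> D') = (\<lambda>h. h \<bullet> D)"
    using assms has_derivative_unique by (auto simp: gderiv_def)
  then have "(D' - D) \<bullet> (D' - D) = 0" by (metis inner_diff_right right_minus_eq)
  then show "D' = D" by simp
qed

lemma C1_grad:
  fixes f :: "'a::euclidean_space \<Rightarrow> real"
  assumes "C1 f"
  shows "(f has_derivative (\<lambda>h. h \<bullet> grad f x)) (at x)" and "continuous_on UNIV (grad f)"
proof -
  obtain f' :: "'a \<Rightarrow> 'a \<Rightarrow>\<^sub>L real" where f':
    "\<And>x. (f has_derivative blinfun_apply (f' x)) (at x)" "continuous_on UNIV f'"
    using assms unfolding C1_def by auto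
  have "blinfun_apply (f' x) = (\<lambda>h. h \<bullet> (\<Sum>b\<in>Basis. blinfun_apply (f' x) b *\<^sub>R b))" for x
  proof
    fix h
    have "blinfun_apply (f' x) h = blinfun_apply (f' x) (\<Sum>b\<in>Basis. (h \<bullet> b) *\<^sub>R b)"
      by (simp add: euclidean_representation)
    then show "blinfun_apply (f' x) h = h \<bullet> (\<Sum>b\<in>Basis. blinfun_apply (f' x) b *\<^sub>R b)"
      by (simp add: blinfun.sum_right blinfun.scaleR_right inner_sum_right mult.commute)
  qed
  then have d: "(f has_derivative (\<lambda>h. h \<bullet> (\<Sum>b\<in>Basis. blinfun_apply (f' x) b *\<^sub>R b))) (at x)" for x
    using f'(1)[of x] by metis
  then have g: "grad f = (\<lambda>x. \<Sum>b\<in>Basis. blinfun_apply (f' x) b *\<^sub>R b)"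
    by (intro ext grad_eqI)
  show "(f has_derivative (\<lambda>h. h \<bullet> grad f x)) (at x)" using d by (simp add: g)
  show "continuous_on UNIV (grad f)" unfolding g using f'(2) by (intro continuous_intros)
qed

lemma C2_imp_C1: "C2 f \<Longrightarrow> C1 f"
  unfolding C1_def C2_def
  by (meson differentiableI differentiable_imp_continuous_on differentiable_on_def differentiable_at_withinI)

lemma C2_lincomb:
  assumes "C2 f" "C2 g"
  shows "C2 (\<lambda>x. f x + a * g x)"
proof -
  obtain f' f'' g' g'' where
    "\<And>x. (f has_derivative blinfun_apply (f' x)) (at x)"
    "\<And>x. (f' has_derivative blinfun_apply (f'' x)) (at x)" "continuous_on UNIV f''"
    "\<And>x. (g has_derivative blinfun_apply (g' x)) (at x)"
    "\<And>x. (g' has_derivative blinfun_apply (g'' x)) (at x)" "continuous_on UNIV g''"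
    using assms unfolding C2_def by auto
  then show ?thesis unfolding C2_def
    by (intro exI[of _ "\<lambda>x. f' x + a *\<^sub>R g' x"] exI[of _ "\<lambda>x. f'' x + a *\<^sub>R g'' x"])
       (auto simp: plus_blinfun.rep_eq scaleR_blinfun.rep_eq
         intro!: has_derivative_add has_derivative_scaleR_right has_derivative_mult_right continuous_intros)
qed

section \<open>Upcrossings and recurrence\<close>

text \<open>
  At the first return to the level \<open>c\<close> the function would have to arrive from above, contrary to
  the positive derivative.
\<close>

lemma stays_above_after_upcrossing:
  fixes f :: "real \<Rightarrow> real"
  assumes d: "\<And>t. (f has_real_derivative f' t) (at t)"
    and up: "\<And>t. f t = c \<Longrightarrow> f' t > 0"
    and a: "f a = c" "a < b"
  shows "f b > c"
proof (rule ccontr)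
  assume "\<not> f b > c"
  obtain e where e: "e > 0" "\<And>h. 0 < h \<Longrightarrow> h < e \<Longrightarrow> f a < f (a + h)"
    using DERIV_pos_inc_right[OF d up[OF a(1)]] by blast
  define s where "s = a + min (e / 2) ((b - a) / 2)"
  have s: "a < s" "s < b" "f s > c"
    using e(2)[of "s - a"] e(1) a by (auto simp: s_def min_def field_simps)
  have cont: "continuous_on A f" for A
    by (intro continuous_at_imp_continuous_on ballI DERIV_isCont[OF d])
  define S where "S = {s..b} \<inter> f -` {..c}"
  have "closed S" unfolding S_def
    by (intro continuous_closed_preimage cont) auto
  moreover have "b \<in> S" using \<open>\<not> f b > c\<close> s by (auto simp: S_def)
  then have "S \<noteq> {}" by blast
  moreover have "bdd_below S" by (auto simp: S_def)
  ultimately have u: "Inf S \<in> S" using closed_contains_Inf by blast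
  define u where "u = Inf S"
  have "s \<le> u" "u \<le> b" "f u \<le> c" using u by (auto simp: S_def u_def)
  have before: "f t > c" if "s \<le> t" "t < u" for t
    using cInf_lower[OF _ \<open>bdd_below S\<close>, of t] that \<open>u \<le> b\<close> by (fastforce simp: S_def u_def)
  have "\<exists>t\<ge>s. t \<le> u \<and> f t = c"
    using IVT2'[of f u c s] \<open>f u \<le> c\<close> s \<open>s \<le> u\<close> cont by auto
  then have "f u = c" using before by (metis order.irrefl order.not_eq_order_implies_strict)
  then obtain e' where e': "e' > 0" "\<And>h. 0 < h \<Longrightarrow> h < e' \<Longrightarrow> f (u - h) < f u"
    using DERIV_pos_inc_left[OF d up] by blast
  have "s < u" using \<open>s \<le> u\<close> \<open>f u = c\<close> s by (cases "s = u") auto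
  define h where "h = min (e' / 2) (u - s)"
  have "h > 0" "h < e'" "s \<le> u - h" using e'(1) \<open>s < u\<close> by (auto simp: h_def)
  then show False using e'(2)[of h] before[of "u - h"] \<open>f u = c\<close> by linarith
qed

text \<open>
  Recurrence of linear flows on the torus, by Dirichlet's simultaneous approximation theorem.
\<close>

lemma ex_near_integer_multiple:
  fixes p :: "real ^ 'n::finite"
  assumes "e > 0"
  shows "\<exists>k::nat. k > 0 \<and> (\<exists>m. (\<forall>i. m $ i \<in> \<int>) \<and> norm (real k *\<^sub>R p - m) < e)"
proof -
  obtain b where b: "bij_betw b {0..<CARD('n)} (UNIV :: 'n set)"
    using ex_bij_betw_nat_finite[of "UNIV :: 'n set"] by auto
  obtain N where N_gt: "real CARD('n) / e < real N"
    using reals_Archimedean2 by blast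
  moreover have "0 \<le> real CARD('n) / e" using assms by simp
  ultimately have "0 < real N" by linarith
  then have N: "N > 0" "real CARD('n) / e < real N" using N_gt by simp_all
  obtain q r where q: "0 < q" "\<And>i. i < CARD('n) \<Longrightarrow> \<bar>of_int q * (p $ b i) - of_int (r i)\<bar> < 1 / real N"
    by (rule Dirichlet_approx_simult[OF N(1), of "CARD('n)" "\<lambda>i. p $ b i"]) (rule that)
  define m :: "real ^ 'n" where "m = (\<chi> i. of_int (r (inv_into {0..<CARD('n)} b i)))"
  have "\<bar>(real (nat q) *\<^sub>R p - m) $ i\<bar> < 1 / real N" for i
  proof -
    define j where "j = inv_into {0..<CARD('n)} b i"
    have "j < CARD('n)" "b j = i"
      using b inv_into_into[of i b "{0..<CARD('n)}"] f_inv_into_f[of i b "{0..<CARD('n)}"]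
      by (auto simp: j_def bij_betw_def)
    then show ?thesis using q(2)[of j] q(1) by (simp add: m_def flip: j_def)
  qed
  then have "norm (real (nat q) *\<^sub>R p - m) \<le> (\<Sum>i\<in>(UNIV :: 'n set). 1 / real N)"
    by (intro order_trans[OF norm_le_l1_cart] sum_mono less_imp_le)
  also have "\<dots> < e" using N assms by (simp add: field_simps)
  finally show ?thesis using q(1) by (intro exI[of _ "nat q"] conjI exI[of _ m]) (auto simp: m_def)
qed

section \<open>Topology of the torus and of phase space\<close>

lemma to_torus_rep: "to_torus (rep_torus x) = x"
  by (rule Quotient_abs_rep[OF Quotient_torus])

lemma continuous_on_to_torus: "continuous_on UNIV (to_torus :: real ^ 'n::finite \<Rightarrow> 'n torus)"
  by (auto simp: continuous_on_open_vimage open_torus_def)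

text \<open>
  The saturation of an open set is the union of its integer translates.
\<close>

lemma open_to_torus_image:
  fixes U :: "(real ^ 'n::finite) set"
  assumes "open U"
  shows "open (to_torus ` U)"
proof -
  have "to_torus -` to_torus ` U = (\<Union>k\<in>{k. \<forall>i. k $ i \<in> \<int>}. (+) k ` U)"
  proof (intro equalityI subsetI)
    fix x assume "x \<in> to_torus -` to_torus ` U"
    then obtain y where y: "y \<in> U" "to_torus x = to_torus y" by auto
    then have "x = (x - y) + y" "\<forall>i. (x - y) $ i \<in> \<int>" by (auto simp: to_torus_eq_iff)
    then show "x \<in> (\<Union>k\<in>{k. \<forall>i. k $ i \<in> \<int>}. (+) k ` U)" using y by blast
  next
    fix x assume "x \<in> (\<Union>k\<in>{k. \<forall>i. k $ i \<in> \<int>}. (+) k ` U)"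
    then obtain k y where "\<forall>i. k $ i \<in> \<int>" "y \<in> U" "x = k + y" by auto
    then have "to_torus x = to_torus y" by (simp add: to_torus_eq_iff)
    then show "x \<in> to_torus -` to_torus ` U" using \<open>y \<in> U\<close> by auto
  qed
  then show ?thesis
    unfolding open_torus_def using assms by (auto intro!: open_UN open_translation)
qed

lemma continuous_on_torusI:
  fixes f :: "'n::finite torus \<Rightarrow> 'a::topological_space"
  assumes "continuous_on UNIV (\<lambda>x. f (to_torus x))"
  shows "continuous_on UNIV f"
  using assms by (auto simp: continuous_on_open_vimage open_torus_def vimage_def)

lemma ex_to_torus_unit_cube: "\<exists>y\<in>cbox 0 1. to_torus y = (x :: 'n::finite torus)"
proof
  define y where "y = (\<chi> i. frac (rep_torus x $ i))"
  show "y \<in> cbox 0 1" by (auto simp: y_def mem_box_cart frac_lt_1 less_imp_le)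
  have "to_torus y = to_torus (rep_torus x)" by (simp add: to_torus_eq_iff y_def frac_def)
  then show "to_torus y = x" by (simp add: to_torus_rep)
qed

lemma compact_UNIV_torus: "compact (UNIV :: 'n::finite torus set)"
proof -
  have "UNIV = to_torus ` cbox (0 :: real ^ 'n) 1" using ex_to_torus_unit_cube by (metis UNIV_eq_I imageI)
  then show ?thesis
    using compact_continuous_image[OF continuous_on_subset[OF continuous_on_to_torus] compact_cbox]
    by (metis subset_UNIV)
qed

text \<open>
  The periodic functions \<open>sin (2 \<pi> x\<^sub>i)\<close> and \<open>cos (2 \<pi> x\<^sub>i)\<close> are continuous on the torus and
  separate its points. The Hausdorff property ensures that compact sets are Borel, as is
  required in the definition of a Radon measure.
\<close>

instance torus :: (finite) t2_space
proof
  fix x y :: "'a torus" assume "x \<noteq> y"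
  define circ where "circ i z = (sin (2 * pi * rep_torus z $ i), cos (2 * pi * rep_torus z $ i))"
    for i and z :: "'a torus"
  have circ: "circ i (to_torus v) = (sin (2 * pi * v $ i), cos (2 * pi * v $ i))" for i v
  proof -
    obtain m where "rep_torus (to_torus v) $ i - v $ i = of_int m"
      using to_torus_rep[of "to_torus v"] by (auto simp: to_torus_eq_iff elim: Ints_cases)
    then have "2 * pi * rep_torus (to_torus v) $ i = 2 * pi * v $ i + 2 * pi * of_int m"
      by (simp add: algebra_simps)
    then show ?thesis unfolding circ_def prod.inject sin_cos_eq_iff by blast
  qed
  have cont: "continuous_on UNIV (circ i)" for i
    by (rule continuous_on_torusI) (auto simp: circ intro!: continuous_intros)
  have "\<exists>i. circ i x \<noteq> circ i y"
  proof (rule ccontr)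
    assume "\<nexists>i. circ i x \<noteq> circ i y"
    then have "\<exists>m::int. 2 * pi * rep_torus x $ i = 2 * pi * rep_torus y $ i + 2 * pi * m" for i
      unfolding circ_def prod.inject sin_cos_eq_iff by auto
    then have "\<exists>m::int. 2 * pi * (rep_torus x $ i - rep_torus y $ i) = 2 * pi * m" for i
      by (simp add: algebra_simps)
    then have "rep_torus x $ i - rep_torus y $ i \<in> \<int>" for i by (auto simp: Ints_def)
    then have "to_torus (rep_torus x) = to_torus (rep_torus y)" by (simp add: to_torus_eq_iff)
    then show False using \<open>x \<noteq> y\<close> by (simp add: to_torus_rep)
  qed
  then obtain i where "circ i x \<noteq> circ i y" by blast
  then obtain U V where UV: "open U" "open V" "circ i x \<in> U" "circ i y \<in> V" "U \<inter> V = {}"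
    using hausdorff by metis
  show "\<exists>U V. open U \<and> open V \<and> x \<in> U \<and> y \<in> V \<and> U \<inter> V = {}"
    using UV open_vimage[OF UV(1) cont[of i]] open_vimage[OF UV(2) cont[of i]]
    by (intro exI[of _ "circ i -` U"] exI[of _ "circ i -` V"]) auto
qed

definition to_phase :: "(real ^ 'n) \<times> (real ^ 'n) \<Rightarrow> 'n::finite torus \<times> (real ^ 'n)" where
  "to_phase = (\<lambda>(x, p). (to_torus x, p))"

lemma to_phase_pair [simp]: "to_phase (x, p) = (to_torus x, p)"
  by (simp add: to_phase_def)

lemma surj_to_phase: "surj to_phase"
  unfolding surj_def by (metis surj_pair to_phase_pair to_torus_rep)

lemma continuous_on_to_phase: "continuous_on UNIV to_phase"
  unfolding to_phase_def case_prod_beta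
  by (intro continuous_intros continuous_on_compose2[OF continuous_on_to_torus]) auto

text \<open>
  A product of quotient maps need not be a quotient map, but here \<open>to_torus\<close> is open, and
  products of open maps are open.
\<close>

lemma continuous_on_phaseI:
  fixes f :: "'n::finite torus \<times> (real ^ 'n) \<Rightarrow> 'a::topological_space"
  assumes "continuous_on UNIV (\<lambda>z. f (to_phase z))"
  shows "continuous_on UNIV f"
proof -
  have "open (f -` S)" if "open S" for S
  proof (subst open_prod_def, intro ballI)
    fix w assume "w \<in> f -` S"
    obtain x p where w: "w = to_phase (x, p)" using surj_to_phase by (metis surjD surj_pair)
    have "open ((\<lambda>z. f (to_phase z)) -` S)" using open_vimage[OF that assms] .
    moreover have "(x, p) \<in> (\<lambda>z. f (to_phase z)) -` S" using \<open>w \<in> f -` S\<close> w by simp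
    ultimately obtain A B where AB: "open A" "open B" "(x, p) \<in> A \<times> B"
      "A \<times> B \<subseteq> (\<lambda>z. f (to_phase z)) -` S" by (rule open_prod_elim)
    have "to_torus ` A \<times> B \<subseteq> f -` S" using AB(4) by force
    then show "\<exists>A B. open A \<and> open B \<and> w \<in> A \<times> B \<and> A \<times> B \<subseteq> f -` S"
      using AB(1-3) w open_to_torus_image[OF AB(1)]
      by (intro exI[of _ "to_torus ` A"] exI[of _ B]) auto
  qed
  then show ?thesis by (simp add: continuous_on_open_vimage)
qed

section \<open>Gradients of functions on the torus\<close>

lemma C1_torus_if_C2_torus: "C2_torus \<phi> \<Longrightarrow> C1_torus \<phi>"
  by (simp add: C1_torus_def C2_torus_def C2_imp_C1)

lemma C1_torus_grad:
  assumes "C1_torus \<phi>"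
  shows "((\<lambda>y. \<phi> (to_torus y)) has_derivative (\<lambda>h. h \<bullet> torus_grad \<phi> (to_torus x))) (at x)"
    and "continuous_on UNIV (\<lambda>x. torus_grad \<phi> (to_torus x))"
    and "continuous_on UNIV \<phi>"
proof -
  note g = C1_grad[OF assms[unfolded C1_torus_def]]
  show d: "((\<lambda>y. \<phi> (to_torus y)) has_derivative (\<lambda>h. h \<bullet> torus_grad \<phi> (to_torus x))) (at x)" for x
    using g(1)[of x] by (simp add: torus_grad_to_torus o_def)
  show "continuous_on UNIV (\<lambda>x. torus_grad \<phi> (to_torus x))"
    using g(2) by (simp add: torus_grad_to_torus)
  have "continuous_on UNIV (\<lambda>y. \<phi> (to_torus y))"
    using has_derivative_continuous[OF d] by (simp add: continuous_on_eq_continuous_within)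
  then show "continuous_on UNIV \<phi>" by (rule continuous_on_torusI)
qed

lemma torus_grad_lincomb:
  assumes "C1_torus \<phi>" "C1_torus \<psi>"
  shows "torus_grad (\<lambda>x. \<phi> x + a * \<psi> x) (to_torus x) = torus_grad \<phi> (to_torus x) + a *\<^sub>R torus_grad \<psi> (to_torus x)"
proof -
  have "((\<lambda>y. \<phi> (to_torus y) + a * \<psi> (to_torus y)) has_derivative
     (\<lambda>h. h \<bullet> (torus_grad \<phi> (to_torus x) + a *\<^sub>R torus_grad \<psi> (to_torus x)))) (at x)"
    unfolding inner_add_right inner_scaleR_right
    by (intro has_derivative_add has_derivative_mult_right C1_torus_grad assms)
  then show ?thesis
    unfolding torus_grad_to_torus[of "\<lambda>x. \<phi> x + a * \<psi> x"] by (intro grad_eqI) (simp add: o_def)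
qed

lemma C2_torus_lincomb:
  "C2_torus \<phi> \<Longrightarrow> C2_torus \<psi> \<Longrightarrow> C2_torus (\<lambda>x. \<phi> x + a * \<psi> x)"
  using C2_lincomb unfolding C2_torus_def o_def by blast

lemma C2_torus_zero: "C2_torus (\<lambda>_. 0)"
  unfolding C2_torus_def C2_def o_def
  by (intro exI[of _ "\<lambda>_. 0"]) (auto intro!: derivative_eq_intros simp: zero_blinfun.rep_eq)

lemma torus_grad_zero: "torus_grad (\<lambda>_. 0) x = 0"
  using grad_eqI[of "(\<lambda>_. 0) \<circ> to_torus" 0] by (auto simp: torus_grad_def o_def)

lemma C2_phase_derivatives:
  assumes "C2_phase H"
  shows "((\<lambda>y. H (to_torus y, p)) has_derivative (\<lambda>h. h \<bullet> Dx H (to_torus x, p))) (at x)"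
    and "continuous_on UNIV (\<lambda>z. H (to_phase z))"
    and "continuous_on UNIV (\<lambda>z. Dx H (to_phase z))"
    and "continuous_on UNIV (\<lambda>z. Dp H (to_phase z))"
proof -
  define F where "F z = H (to_phase z)" for z
  have "C1 F" using C2_imp_C1[OF assms[unfolded C2_phase_def]]
    by (simp add: F_def[abs_def] to_phase_def case_prod_beta')
  note g = C1_grad[OF this]
  have dx: "((\<lambda>y. F (y, p)) has_derivative (\<lambda>h. h \<bullet> fst (grad F (x, p)))) (at x)" for x p
  proof -
    have "((\<lambda>y. F (y, p)) has_derivative (\<lambda>h. (h, 0) \<bullet> grad F (x, p))) (at x)"
      by (rule has_derivative_compose[OF _ g(1)]) (auto intro!: derivative_eq_intros)
    then show ?thesis by (simp add: inner_prod_def)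
  qed
  have dp: "((\<lambda>q. F (x, q)) has_derivative (\<lambda>h. h \<bullet> snd (grad F (x, p)))) (at p)" for x p
  proof -
    have "((\<lambda>q. F (x, q)) has_derivative (\<lambda>h. (0, h) \<bullet> grad F (x, p))) (at p)"
      by (rule has_derivative_compose[OF _ g(1)]) (auto intro!: derivative_eq_intros)
    then show ?thesis by (simp add: inner_prod_def)
  qed
  have Dx: "Dx H (to_phase z) = fst (grad F z)" for z
    using grad_eqI[OF dx, of "snd z" "fst z"]
    by (cases z) (simp add: Dx_def torus_grad_to_torus o_def F_def)
  have Dp: "Dp H (to_phase z) = snd (grad F z)" for z
    using grad_eqI[OF dp, of "fst z" "snd z"]
    by (cases z) (simp add: Dp_def F_def)
  show "((\<lambda>y. H (to_torus y, p)) has_derivative (\<lambda>h. h \<bullet> Dx H (to_torus x, p))) (at x)"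
    using dx[of p x] Dx[of "(x, p)"] by (simp add: F_def)
  have "continuous_on UNIV F"
    using has_derivative_continuous[OF g(1)] by (simp add: continuous_on_eq_continuous_within)
  then show "continuous_on UNIV (\<lambda>z. H (to_phase z))" by (simp add: F_def)
  show "continuous_on UNIV (\<lambda>z. Dx H (to_phase z))" "continuous_on UNIV (\<lambda>z. Dp H (to_phase z))"
    unfolding Dx Dp using g(2) by (auto intro: continuous_intros)
qed

section \<open>Compactness of the level sets\<close>

text \<open>
  Along the line \<open>t \<mapsto> x + t p\<close> the function \<open>h\<close> is below \<open>c\<close> shortly before the time of a crossing and
  above \<open>c\<close> at all later times. By recurrence the line comes back arbitrarily close to a
  point at which \<open>h\<close> is below \<open>c\<close>.
\<close>

lemma no_transversal_level_set_on_torus: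
  fixes h :: "'n::finite torus \<Rightarrow> real"
  assumes d: "\<And>x. ((\<lambda>y. h (to_torus y)) has_derivative (\<lambda>v. v \<bullet> D (to_torus x))) (at x)"
    and up: "\<And>x. h x = c \<Longrightarrow> D x \<bullet> p > 0"
  shows "h x \<noteq> c"
proof
  assume hx: "h x = c"
  define x0 where "x0 = rep_torus x"
  define f where "f t = h (to_torus (x0 + t *\<^sub>R p))" for t
  have df: "(f has_real_derivative D (to_torus (x0 + t *\<^sub>R p)) \<bullet> p) (at t)" for t
  proof -
    have "((\<lambda>t. x0 + t *\<^sub>R p) has_derivative (\<lambda>s. s *\<^sub>R p)) (at t)"
      by (auto intro!: derivative_eq_intros)
    from has_derivative_compose[OF this d]
    show ?thesis by (simp add: f_def[abs_def] has_field_derivative_def inner_commute mult_commute_abs)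
  qed
  have f0: "f 0 = c" by (simp add: f_def x0_def to_torus_rep hx)
  have up': "D (to_torus (x0 + t *\<^sub>R p)) \<bullet> p > 0" if "f t = c" for t
    using up that by (simp add: f_def)
  obtain e where e: "e > 0" "\<And>s. 0 < s \<Longrightarrow> s < e \<Longrightarrow> f (0 - s) < f 0"
    using DERIV_pos_inc_left[OF df up'[OF f0]] by blast
  \<comment> \<open>The bound \<open>s < 1\<close> makes \<open>k - s\<close> a positive time for every \<open>k \<ge> 1\<close>.\<close>
  define s where "s = min (e / 2) (1 / 2)"
  have s: "0 < s" "s < 1" "f (- s) < c" using e(1) e(2)[of s] f0 by (auto simp: s_def)
  define y where "y = x0 - s *\<^sub>R p"
  have "isCont (\<lambda>y. h (to_torus y)) y" using has_derivative_continuous[OF d] .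
  then obtain r where r: "r > 0"
    "\<And>z. dist z y < r \<Longrightarrow> dist (h (to_torus z)) (h (to_torus y)) < c - f (- s)"
    unfolding continuous_at_eps_delta using s(3) by (metis diff_gt_0_iff_gt)
  obtain k :: nat and m where k: "k > 0" "\<And>i. m $ i \<in> \<int>" "norm (real k *\<^sub>R p - m) < r"
    using ex_near_integer_multiple[OF r(1), of p] by blast
  define z where "z = x0 + (real k - s) *\<^sub>R p - m"
  have "z - y = real k *\<^sub>R p - m" by (simp add: z_def y_def algebra_simps)
  then have "dist z y < r" using k(3) by (simp add: dist_norm)
  moreover have "to_torus z = to_torus (x0 + (real k - s) *\<^sub>R p)"
    using k(2) by (simp add: to_torus_eq_iff z_def)
  then have "h (to_torus z) = f (real k - s)" by (simp add: f_def)
  moreover have "h (to_torus y) = f (- s)" by (simp add: f_def y_def)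
  ultimately have "f (real k - s) < c" using r(2)[of z] by (simp add: dist_real_def)
  moreover have "real k \<ge> 1" using k(1) by simp
  then have "f (real k - s) > c"
    using stays_above_after_upcrossing[OF df up' f0] s(2) by simp
  ultimately show False by simp
qed

text \<open>
  Where \<open>H = c\<close>, the quantity in (A1) is \<open>c\<^sup>2 / 2 + D\<^sub>xH \<bullet> p\<close>. Once it exceeds \<open>c\<^sup>2 / 2\<close>, the function
  \<open>H(\<cdot>, p)\<close> could attain \<open>c\<close> only with a positive derivative in the direction \<open>p\<close>, which is
  impossible on the torus.
\<close>

lemma level_set_bounded:
  fixes H :: "'n::finite torus \<times> (real ^ 'n) \<Rightarrow> real"
  assumes H: "C2_phase H" and A1: "cond_A1 H"
  shows "\<exists>R. \<forall>x p. H (x, p) = c \<longrightarrow> norm p \<le> R"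
proof -
  note der = C2_phase_derivatives[OF H]
  define G where "G p x = (1/2) * (H (x, p))\<^sup>2 + Dx H (x, p) \<bullet> p" for p x
  have "\<forall>\<^sub>F p in at_infinity. (1/2) * c\<^sup>2 < (INF x. G p x)"
    using A1 unfolding cond_A1_def G_def filterlim_at_top_dense by blast
  then obtain R where R: "\<And>p. R \<le> norm p \<Longrightarrow> (1/2) * c\<^sup>2 < (INF x. G p x)"
    unfolding eventually_at_infinity by blast
  have "H (x, p) \<noteq> c" if p: "R \<le> norm p" for x p
  proof (rule no_transversal_level_set_on_torus[where D = "\<lambda>x. Dx H (x, p)" and p = p, OF der(1)])
    fix x assume "H (x, p) = c"
    have pair: "continuous_on UNIV (\<lambda>y. (y, p))" by (intro continuous_intros)
    have "continuous_on UNIV (\<lambda>y. G p (to_torus y))"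
      unfolding G_def
      using continuous_on_compose2[OF der(2) pair] continuous_on_compose2[OF der(3) pair]
      by (auto intro!: continuous_intros)
    then have "continuous_on UNIV (G p)" by (rule continuous_on_torusI)
    then have "bdd_below (range (G p))"
      by (intro bounded_imp_bdd_below compact_imp_bounded compact_continuous_image compact_UNIV_torus)
    then have "(INF x. G p x) \<le> G p x" by (rule cINF_lower) simp
    then show "Dx H (x, p) \<bullet> p > 0" using R[OF p] \<open>H (x, p) = c\<close> by (simp add: G_def)
  qed
  then show ?thesis by (intro exI[of _ R]) (metis less_imp_le linorder_not_le)
qed

section \<open>Existence of a Mather measure\<close>

text \<open>
  At a maximum point of \<open>v - \<phi>\<close> the subsolution property applies, at a minimum point the
  supersolution property; the intermediate value theorem on the connected torus does the rest.
\<close>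

lemma viscosity_solution_gradient_touch:
  fixes H :: "'n::finite torus \<times> (real ^ 'n) \<Rightarrow> real"
  assumes H: "C2_phase H" and v: "viscosity_solution H c v" and \<phi>: "C1_torus \<phi>"
  shows "\<exists>x. H (x, torus_grad \<phi> x) = c"
proof -
  note \<phi>' = C1_torus_grad[OF \<phi>]
  have cont: "continuous_on UNIV (\<lambda>x. v x - \<phi> x)"
    using v \<phi>'(3) unfolding viscosity_solution_def by (auto intro: continuous_intros)
  obtain x1 where "\<And>y. v y - \<phi> y \<le> v x1 - \<phi> x1"
    using continuous_attains_sup[OF compact_UNIV_torus _ cont] by auto
  then have x1: "H (x1, torus_grad \<phi> x1) \<le> c"
    using v \<phi> unfolding viscosity_solution_def viscosity_subsolution_def by simp
  obtain x2 where "\<And>y. v y - \<phi> y \<ge> v x2 - \<phi> x2"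
    using continuous_attains_inf[OF compact_UNIV_torus _ cont] by auto
  then have x2: "H (x2, torus_grad \<phi> x2) \<ge> c"
    using v \<phi> unfolding viscosity_solution_def viscosity_supersolution_def by simp
  define w where "w y = H (to_phase (y, torus_grad \<phi> (to_torus y)))" for y
  have "continuous_on UNIV w" unfolding w_def
    by (intro continuous_on_compose2[OF C2_phase_derivatives(2)[OF H]] continuous_intros \<phi>'(2)) auto
  then have conn: "connected (range w)" by (intro connected_continuous_image) auto
  have "w (rep_torus x) = H (x, torus_grad \<phi> x)" for x
    by (simp add: w_def to_torus_rep)
  then have mem: "H (x, torus_grad \<phi> x) \<in> range w" for x by (metis rangeI)
  have "c \<in> range w" by (rule connectedD_interval[OF conn mem mem x1 x2])
  then show ?thesis by (auto simp: w_def)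
qed

text \<open>
  Inner regularity holds on the Euclidean space above, and images of compact sets are compact.
\<close>

lemma radon_prob_distr_to_phase:
  fixes \<mu> :: "((real ^ 'n::finite) \<times> (real ^ 'n)) measure"
  assumes "prob_space \<mu>" "sets \<mu> = sets borel"
  shows "radon_prob (distr \<mu> borel to_phase)"
proof -
  have m: "to_phase \<in> measurable \<mu> borel"
    using borel_measurable_continuous_onI[OF continuous_on_to_phase] assms(2)
    by (simp cong: measurable_cong_sets)
  define \<nu> where "\<nu> = distr \<mu> borel to_phase"
  have sp: "space \<mu> = UNIV" using sets_eq_imp_space_eq[OF assms(2)] by simp
  have "emeasure \<nu> A = (SUP L \<in> {L. compact L \<and> L \<in> sets \<nu> \<and> L \<subseteq> A}. emeasure \<nu> L)"
    if A: "A \<in> sets \<nu>" for A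
  proof (rule antisym)
    have A': "to_phase -` A \<in> sets borel"
      using measurable_sets[OF m, of A] A assms(2) sp by (simp add: \<nu>_def)
    have "emeasure \<nu> A = emeasure \<mu> (to_phase -` A)"
      using A m sp by (simp add: \<nu>_def emeasure_distr)
    also have "\<dots> = (SUP L \<in> {L. L \<subseteq> to_phase -` A \<and> compact L}. emeasure \<mu> L)"
      using inner_regular[OF assms(2) _ A'] prob_space.emeasure_space_1[OF assms(1)] by simp
    also have "\<dots> \<le> (SUP L \<in> {L. compact L \<and> L \<in> sets \<nu> \<and> L \<subseteq> A}. emeasure \<nu> L)"
    proof (rule SUP_mono)
      fix L assume L: "L \<in> {L. L \<subseteq> to_phase -` A \<and> compact L}"
      have c: "compact (to_phase ` L)"
        using L by (intro compact_continuous_image continuous_on_subset[OF continuous_on_to_phase]) auto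
      then have s: "to_phase ` L \<in> sets borel" by (intro borel_closed compact_imp_closed)
      have "emeasure \<mu> L \<le> emeasure \<mu> (to_phase -` to_phase ` L \<inter> space \<mu>)"
        using measurable_sets[OF m s] sp by (intro emeasure_mono) auto
      also have "\<dots> = emeasure \<nu> (to_phase ` L)"
        unfolding \<nu>_def using m s by (simp add: emeasure_distr)
      finally show "\<exists>L'\<in>{L. compact L \<and> L \<in> sets \<nu> \<and> L \<subseteq> A}. emeasure \<mu> L \<le> emeasure \<nu> L'"
        using L c s by (intro bexI[of _ "to_phase ` L"]) (auto simp: \<nu>_def)
    qed
    finally show "emeasure \<nu> A \<le> (SUP L \<in> {L. compact L \<and> L \<in> sets \<nu> \<and> L \<subseteq> A}. emeasure \<nu> L)" .
    show "(SUP L \<in> {L. compact L \<and> L \<in> sets \<nu> \<and> L \<subseteq> A}. emeasure \<nu> L) \<le> emeasure \<nu> A"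
      using A by (intro SUP_least emeasure_mono) auto
  qed
  then show ?thesis
    unfolding radon_prob_def using prob_space.prob_space_distr[OF assms(1) m] by (simp add: \<nu>_def)
qed

text \<open>
  Here the cell problem yields a point of the level set that kills a given test direction:
  the gradient of \<open>- \<phi> / a\<close> itself reaches the level set somewhere.
\<close>

lemma ex_level_point_cancelling:
  fixes H :: "'n::finite torus \<times> (real ^ 'n) \<Rightarrow> real"
  assumes H: "C2_phase H" and v: "viscosity_solution H c v" and \<phi>: "C2_torus \<phi>" and a: "a \<noteq> 0"
  shows "\<exists>x p. H (x, p) = c \<and> torus_grad \<phi> x + a *\<^sub>R p = 0"
proof -
  define \<psi> where "\<psi> x = 0 + (- 1 / a) * \<phi> x" for x
  have \<psi>: "C2_torus \<psi>" unfolding \<psi>_def[abs_def] by (intro C2_torus_lincomb C2_torus_zero \<phi>)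
  obtain x where x: "H (x, torus_grad \<psi> x) = c"
    using viscosity_solution_gradient_touch[OF H v C1_torus_if_C2_torus[OF \<psi>]] by blast
  have "torus_grad \<psi> x = (- 1 / a) *\<^sub>R torus_grad \<phi> x"
    using torus_grad_lincomb[OF C2_torus_zero[THEN C1_torus_if_C2_torus]
        \<phi>[THEN C1_torus_if_C2_torus], of "- 1 / a" "rep_torus x"]
    by (simp add: \<psi>_def[abs_def] to_torus_rep torus_grad_zero)
  then have "torus_grad \<phi> x + a *\<^sub>R torus_grad \<psi> x = 0" using a by simp
  then show ?thesis using x by blast
qed

text \<open>
  This covers test functions without the term \<open>a p\<close>. The touching argument applied to \<open>\<phi>\<close> alone would
  need points of the level set above a critical point of \<open>\<phi>\<close>; letting \<open>a\<close> tend to 0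
  on a compact set avoids the question.
\<close>

lemma ex_nonpos_if_perturbations_vanish:
  fixes f g :: "'a::topological_space \<Rightarrow> real"
  assumes K: "compact K" and f: "continuous_on K f" and g: "continuous_on K g"
    and zero: "\<And>a. a \<noteq> 0 \<Longrightarrow> \<exists>z\<in>K. f z + a * g z = 0"
  shows "\<exists>z\<in>K. f z \<le> 0"
proof -
  have "K \<noteq> {}" using zero[of 1] by auto
  then obtain z0 where z0: "z0 \<in> K" "\<And>z. z \<in> K \<Longrightarrow> f z0 \<le> f z"
    using continuous_attains_inf[OF K _ f] by blast
  obtain B where B: "B > 0" "\<And>z. z \<in> K \<Longrightarrow> \<bar>g z\<bar> \<le> B"
    using compact_imp_bounded[OF compact_continuous_image[OF g K]]
    unfolding bounded_pos by auto
  have "f z0 \<le> 0 + e" if e: "e > 0" for e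
  proof -
    obtain z where z: "z \<in> K" "f z + (e / B) * g z = 0"
      using zero[of "e / B"] e B(1) by auto
    have "\<bar>(e / B) * g z\<bar> \<le> (e / B) * B"
      unfolding abs_mult using B z(1) e by (intro mult_mono) auto
    also have "\<dots> = e" using B(1) by simp
    finally have "- e \<le> (e / B) * g z" by (metis abs_le_iff minus_le_iff)
    then show ?thesis using z(2) z0(2)[OF z(1)] by linarith
  qed
  then have "f z0 \<le> 0" by (rule field_le_epsilon)
  then show ?thesis using z0(1) by blast
qed

definition flow_pairing ::
    "('n::finite torus \<times> (real ^ 'n) \<Rightarrow> real) \<Rightarrow> ('n torus \<Rightarrow> real) \<Rightarrow> 'n torus \<times> (real ^ 'n) \<Rightarrow> real" where
  "flow_pairing H \<phi> = (\<lambda>(x, p). Dp H (x, p) \<bullet> torus_grad \<phi> x)"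

definition radial_pairing ::
    "('n::finite torus \<times> (real ^ 'n) \<Rightarrow> real) \<Rightarrow> 'n torus \<times> (real ^ 'n) \<Rightarrow> real" where
  "radial_pairing H = (\<lambda>(x, p). Dp H (x, p) \<bullet> p)"

lemma continuous_on_flow_pairing:
  assumes H: "C2_phase H" and \<phi>: "C2_torus \<phi>"
  shows "continuous_on UNIV (\<lambda>z. flow_pairing H \<phi> (to_phase z))"
proof -
  have "continuous_on UNIV (\<lambda>z. torus_grad \<phi> (to_torus (fst z)))"
    by (intro continuous_on_compose2[OF C1_torus_grad(2)[OF C1_torus_if_C2_torus[OF \<phi>]]]
        continuous_intros) auto
  moreover have "flow_pairing H \<phi> (to_phase z) = Dp H (to_phase z) \<bullet> torus_grad \<phi> (to_torus (fst z))" for z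
    by (cases z) (simp add: flow_pairing_def)
  ultimately show ?thesis using C2_phase_derivatives(4)[OF H] by (auto intro: continuous_intros)
qed

lemma continuous_on_radial_pairing:
  assumes H: "C2_phase H"
  shows "continuous_on UNIV (\<lambda>z. radial_pairing H (to_phase z))"
proof -
  have "radial_pairing H (to_phase z) = Dp H (to_phase z) \<bullet> snd z" for z
    by (cases z) (simp add: radial_pairing_def)
  then show ?thesis using C2_phase_derivatives(4)[OF H] by (auto intro!: continuous_intros)
qed

lemma flow_pairing_lincomb:
  assumes "C2_torus \<phi>" "C2_torus \<psi>"
  shows "flow_pairing H (\<lambda>x. \<phi> x + a * \<psi> x) w = flow_pairing H \<phi> w + a * flow_pairing H \<psi> w"
proof -
  obtain x p where "w = to_phase (x, p)" using surj_to_phase by (metis surjD surj_pair)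
  then show ?thesis
    using torus_grad_lincomb[OF assms[THEN C1_torus_if_C2_torus], of a x]
    by (simp add: flow_pairing_def inner_add_right)
qed

lemma flow_pairing_zero: "flow_pairing H (\<lambda>_. 0) w = 0"
  by (cases w) (simp add: flow_pairing_def torus_grad_zero)

text \<open>
  A measure carried by a compact set integrates every continuous function, which settles all the
  integrability requirements at once.
\<close>

lemma mather_measure_distr_to_phase:
  fixes H :: "'n::finite torus \<times> (real ^ 'n) \<Rightarrow> real"
  assumes H: "C2_phase H" and K: "compact K" and HK: "\<And>z. z \<in> K \<Longrightarrow> H (to_phase z) = c"
    and \<mu>: "prob_space \<mu>" "sets \<mu> = sets borel" "AE z in \<mu>. z \<in> K"
    and flow: "\<And>\<phi>. C2_torus \<phi> \<Longrightarrow> (\<integral>z. flow_pairing H \<phi> (to_phase z) \<partial>\<mu>) = 0"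
    and radial: "(\<integral>z. radial_pairing H (to_phase z) \<partial>\<mu>) = 0"
  shows "mather_measure H c (distr \<mu> borel to_phase)"
proof -
  note contH = C2_phase_derivatives(2)[OF H]
  define \<nu> where "\<nu> = distr \<mu> borel to_phase"
  have m: "to_phase \<in> measurable \<mu> borel"
    using borel_measurable_continuous_onI[OF continuous_on_to_phase] \<mu>(2)
    by (simp cong: measurable_cong_sets)
  have int: "integrable \<nu> F \<and> integral\<^sup>L \<nu> F = (\<integral>z. F (to_phase z) \<partial>\<mu>)"
    if F: "continuous_on UNIV (\<lambda>z. F (to_phase z))" for F :: "'n torus \<times> (real ^ 'n) \<Rightarrow> real"
  proof -
    have F': "F \<in> borel_measurable borel"
      by (intro borel_measurable_continuous_onI continuous_on_phaseI F)
    obtain B where B: "\<And>z. z \<in> K \<Longrightarrow> norm (F (to_phase z)) \<le> B"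
      using compact_imp_bounded[OF compact_continuous_image[OF continuous_on_subset[OF F subset_UNIV] K]]
      unfolding bounded_iff by auto
    have "(\<lambda>z. F (to_phase z)) \<in> borel_measurable \<mu>"
      using measurable_compose[OF m F'] .
    then have "integrable \<mu> (\<lambda>z. F (to_phase z))"
      using \<mu>(3) B by (intro finite_measure.integrable_const_bound[OF prob_space.axioms(1)[OF \<mu>(1)], where B = B]) (auto elim!: eventually_mono)
    then show ?thesis
      unfolding \<nu>_def using integrable_distr_eq[OF m F'] integral_distr[OF m F'] by simp
  qed
  have AE_H: "AE z in \<mu>. H (to_phase z) = c" using \<mu>(3) by eventually_elim (rule HK)
  have Hm: "H \<in> borel_measurable borel"
    by (intro borel_measurable_continuous_onI continuous_on_phaseI contH)
  then have "{w \<in> space borel. H w = c} \<in> sets borel" by measurable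
  then have AE_\<nu>: "AE w in \<nu>. H w = c"
    unfolding \<nu>_def using AE_H AE_distr_iff[OF m, of "\<lambda>w. H w = c"] by simp
  have "(\<integral>z. H (to_phase z) \<partial>\<mu>) = (\<integral>z. c \<partial>\<mu>)"
    using AE_H by (intro integral_cong_AE measurable_compose[OF m Hm]) auto
  then have "integrable \<nu> H \<and> integral\<^sup>L \<nu> H = c \<and> (AE w in \<nu>. H w = c)"
    using int[OF contH] AE_\<nu> prob_space.prob_space[OF \<mu>(1)] by simp
  moreover have "integrable \<nu> (radial_pairing H) \<and> integral\<^sup>L \<nu> (radial_pairing H) = 0"
    using int[OF continuous_on_radial_pairing[OF H]] radial by simp
  moreover have "integrable \<nu> (flow_pairing H \<phi>) \<and> integral\<^sup>L \<nu> (flow_pairing H \<phi>) = 0"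
    if "C2_torus \<phi>" for \<phi>
    using int[OF continuous_on_flow_pairing[OF H that]] flow[OF that] by simp
  ultimately show ?thesis
    using radon_prob_distr_to_phase[OF \<mu>(1,2)]
    unfolding mather_measure_def \<nu>_def radial_pairing_def flow_pairing_def by simp
qed

theorem theorem1p3:
  fixes H :: "'n::finite torus \<times> (real ^ 'n) \<Rightarrow> real"
    and Hbar0 :: real
  assumes "C2_phase H"
    and "is_effective_H0 H Hbar0"
    and "cond_A1 H"
  shows "{\<mu>. mather_measure H Hbar0 \<mu>} \<noteq> {}"
proof -
  define c where "c = Hbar0"
  obtain v where v: "viscosity_solution H c v"
    using assms(2) unfolding is_effective_H0_def c_def by auto
  obtain R where R: "\<And>x p. H (x, p) = c \<Longrightarrow> norm p \<le> R"
    using level_set_bounded[OF assms(1,3), of c] by blast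
  \<comment> \<open>The level set is lifted to the fundamental domain, a subset of a Euclidean space.\<close>
  define K where "K = (cbox 0 1 \<times> cball 0 R) \<inter> (\<lambda>z. H (to_phase z)) -` {c}"
  have K: "compact K" unfolding K_def
    by (intro compact_Int_closed compact_Times compact_cbox compact_cball
        closed_vimage[OF closed_singleton C2_phase_derivatives(2)[OF assms(1)]])
  have lift: "\<exists>y. (y, p) \<in> K \<and> to_torus y = x" if "H (x, p) = c" for x p
    using ex_to_torus_unit_cube[of x] R[OF that] that by (auto simp: K_def)
  define F where "F \<phi> z = flow_pairing H \<phi> (to_phase z)" for \<phi> z
  define P where "P z = radial_pairing H (to_phase z)" for z
  define V where "V = {\<lambda>z. F \<phi> z + a * P z | \<phi> a. C2_torus \<phi>}"
  have contF: "continuous_on A (F \<phi>)" if "C2_torus \<phi>" for \<phi> A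
    unfolding F_def
    using continuous_on_flow_pairing[OF assms(1) that] continuous_on_subset by blast
  have contP: "continuous_on A P" for A
    unfolding P_def
    using continuous_on_radial_pairing[OF assms(1)] continuous_on_subset by blast
  have F_zero: "F (\<lambda>_. 0) z = 0" for z by (simp add: F_def flow_pairing_zero)
  have zero_on_K: "\<exists>z\<in>K. F \<phi> z + a * P z = 0" if \<phi>: "C2_torus \<phi>" and a: "a \<noteq> 0" for \<phi> a
  proof -
    obtain x p where x: "H (x, p) = c" and cancel: "torus_grad \<phi> x + a *\<^sub>R p = 0"
      using ex_level_point_cancelling[OF assms(1) v \<phi> a] by blast
    obtain y where y: "(y, p) \<in> K" "to_torus y = x" using lift[OF x] by blast
    have "F \<phi> (y, p) + a * P (y, p) = Dp H (x, p) \<bullet> (torus_grad \<phi> x + a *\<^sub>R p)"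
      by (simp add: F_def P_def flow_pairing_def radial_pairing_def y(2) inner_add_right)
    then show ?thesis using y(1) cancel by (intro bexI[of _ "(y, p)"]) auto
  qed
  have nonpos: "\<exists>z\<in>K. F \<phi> z + a * P z \<le> 0" if \<phi>: "C2_torus \<phi>" for \<phi> a
  proof (cases "a = 0")
    case False
    then show ?thesis using zero_on_K[OF \<phi>] by (metis order_refl)
  next
    case True
    then show ?thesis
      using ex_nonpos_if_perturbations_vanish[OF K contF[OF \<phi>] contP zero_on_K[OF \<phi>]] by simp
  qed
  have "\<exists>z\<in>K. f z \<le> 0" if "f \<in> V" for f using that nonpos unfolding V_def by auto
  moreover have "continuous_on UNIV f" if "f \<in> V" for f
    using that contF contP unfolding V_def by (auto intro!: continuous_intros)
  moreover have F_in: "F \<phi> \<in> V" if "C2_torus \<phi>" for \<phi>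
    unfolding V_def using that by (auto intro!: exI[of _ \<phi>] exI[of _ "0::real"])
  have P_in: "P \<in> V"
    unfolding V_def using C2_torus_zero F_zero
    by (auto intro!: exI[of _ "\<lambda>_. 0"] exI[of _ "1::real"])
  have "F (\<lambda>_. 0) = (\<lambda>_. 0)" using F_zero by (rule ext)
  then have "(\<lambda>_. 0) \<in> V" using F_in[OF C2_torus_zero] by simp
  moreover have "(\<lambda>z. f z + b * g z) \<in> V" if fg: "f \<in> V" "g \<in> V" for f g b
  proof -
    obtain \<phi> a \<psi> a' where
      f: "f = (\<lambda>z. F \<phi> z + a * P z)" "C2_torus \<phi>" and
      g: "g = (\<lambda>z. F \<psi> z + a' * P z)" "C2_torus \<psi>"
      using fg unfolding V_def by auto
    have "(\<lambda>z. f z + b * g z) = (\<lambda>z. F (\<lambda>x. \<phi> x + b * \<psi> x) z + (a + b * a') * P z)"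
      using flow_pairing_lincomb[OF f(2) g(2)] by (simp add: F_def f g algebra_simps)
    then show ?thesis using C2_torus_lincomb[OF f(2) g(2), of b] unfolding V_def by blast
  qed
  ultimately obtain \<mu> where \<mu>: "prob_space \<mu>" "sets \<mu> = sets borel" "AE z in \<mu>. z \<in> K"
    "\<And>f. f \<in> V \<Longrightarrow> integral\<^sup>L \<mu> f = 0"
    using ex_annihilating_measure[OF K, of V] by blast
  have "mather_measure H c (distr \<mu> borel to_phase)"
  proof (rule mather_measure_distr_to_phase[OF assms(1) K _ \<mu>(1-3)])
    show "H (to_phase z) = c" if "z \<in> K" for z using that by (simp add: K_def)
    show "(\<integral>z. flow_pairing H \<phi> (to_phase z) \<partial>\<mu>) = 0" if "C2_torus \<phi>" for \<phi>
      using \<mu>(4)[OF F_in[OF that]] unfolding F_def .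
    show "(\<integral>z. radial_pairing H (to_phase z) \<partial>\<mu>) = 0"
      using \<mu>(4)[OF P_in] unfolding P_def .
  qed
  then show ?thesis by (auto simp: c_def)
qed

end
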